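(* Let $R\in C^0([0,1],\mathrm{Sym}_n(\mathbb{R}))$ and let $L_R$ be the minimal operator in $L^2((0,1),\mathbb{R}^n)$ induced by the Bessel-type differential expression $$l_R:=-\frac{d^2}{dt^2}+\frac{R(t)}{t^2},\qquad t\in(0,1].$$ If $R(t)>-\tfrac14 I$ for all $t\in[0,1]$ (i.e. all eigenvalues of $R(t)$ are $>-1/4$), then every self-adjoint extension of $L_R$ is a Fredholm operator.
   Context: The minimal operator $L_R$ is the closure of $l_R$ on $C_0^\infty((0,1),\mathbb{R}^n)$ in $L^2((0,1),\mathbb{R}^n)$. A closed operator is Fredholm if it has closed range and finite-dimensional kernel and cokernel. *)

theory Defs
  imports "HOL-Analysis.Analysis"
begin

subsection \<open>The Hilbert space of square-integrable functions on the open unit interval\<close>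

abbreviation I01 :: "real measure"
  where "I01 \<equiv> lebesgue_on {0<..<1}"

definition square_integrable :: "(real \<Rightarrow> 'a::euclidean_space) \<Rightarrow> bool"
  where "square_integrable f \<longleftrightarrow>
    f \<in> borel_measurable I01 \<and> integrable I01 (\<lambda>t. (norm (f t))\<^sup>2)"

definition L2_rel :: "(real \<Rightarrow> 'a::euclidean_space) \<Rightarrow> (real \<Rightarrow> 'a) \<Rightarrow> bool"
  where "L2_rel f g \<longleftrightarrow>
    square_integrable f \<and> square_integrable g \<and> (AE t in I01. f t = g t)"

lemma square_integrable_measurable [measurable_dest]:
  "square_integrable f \<Longrightarrow> f \<in> borel_measurable I01"
  by (simp add: square_integrable_def)

lemma square_integrable_zero: "square_integrable (\<lambda>_. 0)"
  by (simp add: square_integrable_def)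

lemma square_integrable_scaleR:
  "square_integrable f \<Longrightarrow> square_integrable (\<lambda>t. c *\<^sub>R f t)"
  by (auto simp: square_integrable_def power_mult_distrib)

lemma square_integrable_uminus:
  "square_integrable f \<Longrightarrow> square_integrable (\<lambda>t. - f t)"
  using square_integrable_scaleR[of f "-1"] by simp

lemma square_integrable_add:
  assumes f: "square_integrable f" and g: "square_integrable g"
  shows "square_integrable (\<lambda>t. f t + g t)"
proof -
  note [measurable] = square_integrable_measurable[OF f] square_integrable_measurable[OF g]
  have "integrable I01 (\<lambda>t. 2 * (norm (f t))\<^sup>2 + 2 * (norm (g t))\<^sup>2)"
    using f g by (simp add: square_integrable_def)
  then have "integrable I01 (\<lambda>t. (norm (f t + g t))\<^sup>2)"
  proof (rule Bochner_Integration.integrable_bound)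
    have "(norm (f t + g t))\<^sup>2 \<le> 2 * (norm (f t))\<^sup>2 + 2 * (norm (g t))\<^sup>2" for t
    proof -
      have "(norm (f t + g t))\<^sup>2 \<le> (norm (f t) + norm (g t))\<^sup>2"
        by (simp add: norm_triangle_ineq power_mono)
      also have "\<dots> \<le> 2 * (norm (f t))\<^sup>2 + 2 * (norm (g t))\<^sup>2"
        using sum_squares_bound[of "norm (f t)" "norm (g t)"] by (simp add: power2_sum)
      finally show ?thesis .
    qed
    then show "AE t in I01. norm ((norm (f t + g t))\<^sup>2)
        \<le> norm (2 * (norm (f t))\<^sup>2 + 2 * (norm (g t))\<^sup>2)"
      by (intro AE_I2) (simp add: abs_of_nonneg)
  qed simp
  then show ?thesis
    by (simp add: square_integrable_def)
qed

lemma square_integrable_diff: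
  "square_integrable f \<Longrightarrow> square_integrable g \<Longrightarrow> square_integrable (\<lambda>t. f t - g t)"
  using square_integrable_add[of f "\<lambda>t. - g t"] square_integrable_uminus[of g] by simp

lemma square_integrable_inner:
  assumes f: "square_integrable f" and g: "square_integrable g"
  shows "integrable I01 (\<lambda>t. f t \<bullet> g t)"
proof -
  note [measurable] = square_integrable_measurable[OF f] square_integrable_measurable[OF g]
  have "integrable I01 (\<lambda>t. (norm (f t))\<^sup>2 + (norm (g t))\<^sup>2)"
    using f g by (simp add: square_integrable_def)
  then show ?thesis
  proof (rule Bochner_Integration.integrable_bound)
    have "\<bar>f t \<bullet> g t\<bar> \<le> (norm (f t))\<^sup>2 + (norm (g t))\<^sup>2" for t
    proof -
      have "\<bar>f t \<bullet> g t\<bar> \<le> norm (f t) * norm (g t)"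
        by (rule Cauchy_Schwarz_ineq2)
      moreover have "0 \<le> norm (f t) * norm (g t)"
        by simp
      ultimately show ?thesis
        using sum_squares_bound[of "norm (f t)" "norm (g t)"] by linarith
    qed
    then show "AE t in I01. norm (f t \<bullet> g t) \<le> norm ((norm (f t))\<^sup>2 + (norm (g t))\<^sup>2)"
      by (intro AE_I2) simp
  qed simp
qed

lemma part_equivp_L2_rel: "part_equivp (L2_rel :: (real \<Rightarrow> 'a::euclidean_space) \<Rightarrow> _)"
proof (rule part_equivpI)
  show "\<exists>f. L2_rel f (f :: real \<Rightarrow> 'a)"
    using square_integrable_zero by (auto simp: L2_rel_def)
  show "symp (L2_rel :: (real \<Rightarrow> 'a) \<Rightarrow> _)"
    by (auto simp: symp_def L2_rel_def)
  show "transp (L2_rel :: (real \<Rightarrow> 'a) \<Rightarrow> _)"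
  proof (rule transpI)
    fix f g h :: "real \<Rightarrow> 'a"
    assume fg: "L2_rel f g" and gh: "L2_rel g h"
    have "AE t in I01. f t = g t" "AE t in I01. g t = h t"
      using fg gh by (auto simp: L2_rel_def)
    then have "AE t in I01. f t = h t"
      by eventually_elim simp
    with fg gh show "L2_rel f h"
      by (simp add: L2_rel_def)
  qed
qed

quotient_type (overloaded) 'a L2 = "real \<Rightarrow> 'a::euclidean_space" / partial: L2_rel
  morphisms rep_L2 to_L2
  by (rule part_equivp_L2_rel)

text \<open>
  \<^term>\<open>to_L2 f\<close> is the class of \<^term>\<open>f\<close>; it is meaningful only for square-integrable
  \<^term>\<open>f\<close>.
\<close>

instantiation L2 :: (euclidean_space) real_vector
begin

lift_definition zero_L2 :: "'a L2" is "\<lambda>_. 0"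
  by (simp add: L2_rel_def square_integrable_zero)

lift_definition plus_L2 :: "'a L2 \<Rightarrow> 'a L2 \<Rightarrow> 'a L2" is "\<lambda>f g t. f t + g t"
  by (auto simp: L2_rel_def intro: square_integrable_add)

lift_definition minus_L2 :: "'a L2 \<Rightarrow> 'a L2 \<Rightarrow> 'a L2" is "\<lambda>f g t. f t - g t"
  by (auto simp: L2_rel_def intro: square_integrable_diff)

lift_definition uminus_L2 :: "'a L2 \<Rightarrow> 'a L2" is "\<lambda>f t. - f t"
  by (auto simp: L2_rel_def intro: square_integrable_uminus)

lift_definition scaleR_L2 :: "real \<Rightarrow> 'a L2 \<Rightarrow> 'a L2" is "\<lambda>c f t. c *\<^sub>R f t"
  by (auto simp: L2_rel_def intro: square_integrable_scaleR)

instance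
proof
  fix a b c :: "'a L2" and r s :: real
  show "a + b + c = a + (b + c)"
    by transfer (auto simp: L2_rel_def algebra_simps intro!: square_integrable_add)
  show "a + b = b + a"
    by transfer (auto simp: L2_rel_def algebra_simps intro!: square_integrable_add)
  show "0 + a = a"
    by transfer (auto simp: L2_rel_def)
  show "- a + a = 0"
    by transfer (auto simp: L2_rel_def square_integrable_zero)
  show "a - b = a + - b"
    by transfer (auto simp: L2_rel_def intro!: square_integrable_diff)
  show "r *\<^sub>R (a + b) = r *\<^sub>R a + r *\<^sub>R b"
    by transfer (auto simp: L2_rel_def scaleR_add_right[symmetric]
        intro!: square_integrable_scaleR square_integrable_add)
  show "(r + s) *\<^sub>R a = r *\<^sub>R a + s *\<^sub>R a"
    by transfer (auto simp: L2_rel_def scaleR_add_left[symmetric]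
        intro!: square_integrable_scaleR)
  show "r *\<^sub>R s *\<^sub>R a = (r * s) *\<^sub>R a"
    by transfer (auto simp: L2_rel_def intro!: square_integrable_scaleR)
  show "1 *\<^sub>R a = a"
    by transfer (auto simp: L2_rel_def)
qed

end

instantiation L2 :: (euclidean_space) real_inner
begin

lift_definition inner_L2 :: "'a L2 \<Rightarrow> 'a L2 \<Rightarrow> real" is "\<lambda>f g. LINT t|I01. f t \<bullet> g t"
proof -
  fix f f' g g' :: "real \<Rightarrow> 'a"
  assume ff': "L2_rel f f'" and gg': "L2_rel g g'"
  show "(LINT t|I01. f t \<bullet> g t) = (LINT t|I01. f' t \<bullet> g' t)"
  proof (rule integral_cong_AE)
    have "AE t in I01. f t = f' t" "AE t in I01. g t = g' t"
      using ff' gg' by (simp_all add: L2_rel_def)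
    then show "AE t in I01. f t \<bullet> g t = f' t \<bullet> g' t"
      by eventually_elim simp
    have "f \<in> borel_measurable I01" "f' \<in> borel_measurable I01"
      "g \<in> borel_measurable I01" "g' \<in> borel_measurable I01"
      using ff' gg' by (simp_all add: L2_rel_def square_integrable_def)
    then show "(\<lambda>t. f t \<bullet> g t) \<in> borel_measurable I01"
      "(\<lambda>t. f' t \<bullet> g' t) \<in> borel_measurable I01"
      by (simp_all add: borel_measurable_inner)
  qed
qed

definition norm_L2 :: "'a L2 \<Rightarrow> real"
  where "norm_L2 f = sqrt (f \<bullet> f)"

definition dist_L2 :: "'a L2 \<Rightarrow> 'a L2 \<Rightarrow> real"
  where "dist_L2 f g = norm (f - g)"

definition sgn_L2 :: "'a L2 \<Rightarrow> 'a L2"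
  where "sgn_L2 f = f /\<^sub>R norm f"

definition uniformity_L2 :: "('a L2 \<times> 'a L2) filter"
  where "uniformity_L2 = (INF e\<in>{0 <..}. principal {(x, y). dist x y < e})"

definition open_L2 :: "'a L2 set \<Rightarrow> bool"
  where "open_L2 S \<longleftrightarrow> (\<forall>x\<in>S. \<forall>\<^sub>F (x', y) in uniformity. x' = x \<longrightarrow> y \<in> S)"

instance
proof
  fix a b c :: "'a L2" and r :: real
  show "sgn a = a /\<^sub>R norm a"
    by (rule sgn_L2_def)
  show "dist a b = norm (a - b)"
    by (rule dist_L2_def)
  show "(uniformity :: ('a L2 \<times> 'a L2) filter) = (INF e\<in>{0 <..}. principal {(x, y). dist x y < e})"
    by (rule uniformity_L2_def)
  show "open U \<longleftrightarrow> (\<forall>x\<in>U. \<forall>\<^sub>F (x', y) in uniformity. x' = x \<longrightarrow> y \<in> U)" for U :: "'a L2 set"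
    by (rule open_L2_def)
  show "a \<bullet> b = b \<bullet> a"
    by transfer (simp add: inner_commute)
  show "(a + b) \<bullet> c = a \<bullet> c + b \<bullet> c"
    by transfer (auto simp: L2_rel_def inner_add_left square_integrable_inner)
  show "(r *\<^sub>R a) \<bullet> b = r * (a \<bullet> b)"
    by transfer simp
  show "0 \<le> a \<bullet> a"
    by transfer simp
  show "a \<bullet> a = 0 \<longleftrightarrow> a = 0"
  proof transfer
    fix f :: "real \<Rightarrow> 'a"
    assume "L2_rel f f"
    then have f: "square_integrable f"
      by (simp add: L2_rel_def)
    have "(LINT t|I01. f t \<bullet> f t) = 0 \<longleftrightarrow> (AE t in I01. f t \<bullet> f t = 0)"
      by (rule integral_nonneg_eq_0_iff_AE) (auto intro: square_integrable_inner f)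
    then show "(LINT t|I01. f t \<bullet> f t) = 0 \<longleftrightarrow> L2_rel f (\<lambda>_. 0)"
      using f by (simp add: L2_rel_def square_integrable_zero)
  qed
  show "norm a = sqrt (a \<bullet> a)"
    by (rule norm_L2_def)
qed

end


subsection \<open>Unbounded operators\<close>

text \<open>
  An operator in a real inner product space is represented by its graph, so that its domain,
  range and extension order are \<^const>\<open>Domain\<close>, \<^const>\<open>Range\<close> and
  \<^term>\<open>(\<subseteq>)\<close>, and the closure of an operator is the closure of its graph in the
  product topology.
\<close>

type_synonym 'a opgraph = "('a \<times> 'a) set"

definition operator :: "'a::real_inner opgraph \<Rightarrow> bool"
  where "operator A \<longleftrightarrow> subspace A \<and> single_valued A"

definition closed_operator :: "'a::real_inner opgraph \<Rightarrow> bool"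
  where "closed_operator A \<longleftrightarrow> operator A \<and> closed A"

definition op_kernel :: "'a::real_inner opgraph \<Rightarrow> 'a set"
  where "op_kernel A = {x. (x, 0) \<in> A}"

definition op_adjoint :: "'a::real_inner opgraph \<Rightarrow> 'a opgraph"
  where "op_adjoint A = {(y, z). \<forall>(x, w)\<in>A. w \<bullet> y = x \<bullet> z}"

definition self_adjoint :: "'a::real_inner opgraph \<Rightarrow> bool"
  where "self_adjoint A \<longleftrightarrow> operator A \<and> closure (Domain A) = UNIV \<and> op_adjoint A = A"

definition finite_dim :: "'a::real_vector set \<Rightarrow> bool"
  where "finite_dim V \<longleftrightarrow> (\<exists>B. finite B \<and> span B = V)"

text \<open>
  Finite dimension of the quotient of the whole space by a subspace \<^term>\<open>V\<close>: the cosets of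
  finitely many vectors span the quotient.
\<close>

definition finite_codim :: "'a::real_vector set \<Rightarrow> bool"
  where "finite_codim V \<longleftrightarrow> (\<exists>B. finite B \<and> (\<forall>x. \<exists>b\<in>span B. x - b \<in> V))"

definition fredholm :: "'a::real_inner opgraph \<Rightarrow> bool"
  where "fredholm A \<longleftrightarrow> closed_operator A \<and>
    closed (Range A) \<and> finite_dim (op_kernel A) \<and> finite_codim (Range A)"


subsection \<open>The Bessel-type differential operator\<close>

definition iter_deriv :: "nat \<Rightarrow> (real \<Rightarrow> 'a::real_normed_vector) \<Rightarrow> real \<Rightarrow> 'a"
  where "iter_deriv k = (\<lambda>f t. vector_derivative f (at t)) ^^ k"

text \<open>
  Elements of $C_0^\infty((0,1))$ are identified with their extension by zero to the real line.
\<close>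

definition test_function :: "(real \<Rightarrow> 'a::real_normed_vector) \<Rightarrow> bool"
  where "test_function \<phi> \<longleftrightarrow>
    (\<forall>k t. iter_deriv k \<phi> differentiable (at t)) \<and>
    compact (closure {t. \<phi> t \<noteq> 0}) \<and> closure {t. \<phi> t \<noteq> 0} \<subseteq> {0<..<1}"

definition bessel_expr :: "(real \<Rightarrow> real^'n^'n) \<Rightarrow> (real \<Rightarrow> real^'n) \<Rightarrow> real \<Rightarrow> real^'n"
  where "bessel_expr R \<phi> t = - iter_deriv 2 \<phi> t + (1 / t\<^sup>2) *\<^sub>R (R t *v \<phi> t)"

definition minimal_operator :: "(real \<Rightarrow> real^'n^'n) \<Rightarrow> (real^'n) L2 opgraph"
  where "minimal_operator R =
    closure {(to_L2 \<phi>, to_L2 (bessel_expr R \<phi>)) | \<phi>. test_function \<phi>}"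

lemma iter_deriv_continuous:
  "test_function \<phi> \<Longrightarrow> continuous_on S (iter_deriv k \<phi>)"
  unfolding test_function_def
  by (meson continuous_at_imp_continuous_on differentiable_imp_continuous_within)

lemma iter_deriv_eq_0:
  assumes "open U" "\<And>t. t \<in> U \<Longrightarrow> \<phi> t = 0" "t \<in> U"
  shows "iter_deriv k \<phi> t = 0"
  using \<open>t \<in> U\<close>
proof (induction k arbitrary: t)
  case 0
  then show ?case using assms by (simp add: iter_deriv_def)
next
  case (Suc k)
  have "(iter_deriv k \<phi> has_vector_derivative 0) (at t)"
    using has_vector_derivative_transform_within_open[of "\<lambda>_. 0" 0 t U "iter_deriv k \<phi>"]
      Suc assms(1) by auto
  then show ?case
    by (simp add: iter_deriv_def vector_derivative_at)
qed

lemma square_integrable_continuous_supp: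
  fixes f :: "real \<Rightarrow> 'a::euclidean_space"
  assumes cont: "continuous_on {0<..<1} f"
    and K: "compact K" "K \<subseteq> {0<..<1}" "\<And>t. t \<notin> K \<Longrightarrow> f t = 0"
  shows "square_integrable f"
proof -
  have meas: "f \<in> borel_measurable I01"
    using cont by (intro continuous_imp_measurable_on_sets_lebesgue) auto
  have "compact (f ` K)"
    using cont K by (meson compact_continuous_image continuous_on_subset)
  then obtain B where B: "\<And>t. t \<in> K \<Longrightarrow> norm (f t) \<le> B"
    using compact_imp_bounded[of "f ` K"] by (auto simp: bounded_iff)
  have le: "norm ((norm (f t))\<^sup>2) \<le> B\<^sup>2" for t
    using B[of t] K(3)[of t] by (cases "t \<in> K") (auto intro: power_mono)
  interpret finite_measure I01
    by (rule finite_measureI) (simp add: emeasure_restrict_space)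
  have "integrable I01 (\<lambda>t. (norm (f t))\<^sup>2)"
    using le meas by (intro integrable_const_bound[of _ "B\<^sup>2"]) auto
  with meas show ?thesis
    by (simp add: square_integrable_def)
qed

lemma square_integrable_test_function:
  fixes \<phi> :: "real \<Rightarrow> 'a::euclidean_space"
  assumes "test_function \<phi>"
  shows "square_integrable \<phi>"
proof (rule square_integrable_continuous_supp)
  show "continuous_on {0<..<1} \<phi>"
    using iter_deriv_continuous[OF assms, of _ 0] by (simp add: iter_deriv_def)
  show "\<phi> t = 0" if "t \<notin> closure {t. \<phi> t \<noteq> 0}" for t
    using that closure_subset[of "{t. \<phi> t \<noteq> 0}"] by auto
qed (use assms in \<open>auto simp: test_function_def\<close>)

lemma square_integrable_bessel_expr:
  assumes \<phi>: "test_function \<phi>" and R: "continuous_on {0..1} R"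
  shows "square_integrable (bessel_expr R \<phi>)"
proof (rule square_integrable_continuous_supp)
  let ?K = "closure {t. \<phi> t \<noteq> 0}"
  have R': "continuous_on {0<..<1} R"
    using R by (rule continuous_on_subset) auto
  have c0: "continuous_on {0<..<1} \<phi>"
    using iter_deriv_continuous[OF \<phi>, of _ 0] by (simp add: iter_deriv_def)
  show "continuous_on {0<..<1} (bessel_expr R \<phi>)"
    unfolding bessel_expr_def matrix_vector_mult_def
    by (intro continuous_intros iter_deriv_continuous[OF \<phi>] R' c0
        continuous_on_vec_lambda) auto
  show "bessel_expr R \<phi> t = 0" if "t \<notin> ?K" for t
  proof -
    have z: "\<phi> s = 0" if "s \<in> - ?K" for s
      using that closure_subset[of "{t. \<phi> t \<noteq> 0}"] by auto
    have "iter_deriv 2 \<phi> t = 0"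
    proof (rule iter_deriv_eq_0)
      show "open (- ?K)"
        by (rule open_Compl[OF closed_closure])
      show "t \<in> - ?K"
        using that by blast
    qed (rule z)
    moreover have "\<phi> t = 0"
      using z that by blast
    ultimately show ?thesis
      by (simp add: bessel_expr_def)
  qed
qed (use \<phi> in \<open>auto simp: test_function_def\<close>)

end

theory Submission
  imports Defs
begin

text \<open>
  Let $M$ be the closure of the range of $l_R$ on test functions. The theorem rests on two facts
  about test functions: $l_R$ is bounded below, and $M^\perp$ has finite dimension.

  Bounded below: the least eigenvalue of $R(t)$ is attained on the compact set of pairs $(t, v)$
  with $|v| = 1$, so that $R(t) \ge (\varepsilon - \frac14) I$ with one $\varepsilon > 0$ for all
  $t$ (\<open>uniform_lower_bound\<close>). Hardy's inequality
  $\int |\varphi'|^2 \ge \frac14 \int |\varphi|^2/t^2$ absorbs the part $-\frac14$ and leaves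
  $\langle l_R\varphi, \varphi\rangle \ge \varepsilon \int |\varphi|^2/t^2 \ge
  \varepsilon \|\varphi\|^2$ (\<open>bessel_coercive_inner\<close>). Since $L^2$ is complete, every element of
  $M$ is therefore a value of the minimal operator
  (\<open>closure_range_subset_range_closure\<close>), hence of each of its extensions.

  Finite dimension: an element of $M^\perp$ is a weak solution of $u'' = R u / t^2$. By the lemma of
  du Bois-Reymond it agrees almost everywhere with an affine function plus the second primitive of
  $R u / t^2$ based at $t = 1$, where the equation is regular
  (\<open>weak_solution_representation\<close>), and Gronwall's argument shows that the affine function
  determines $u$ (\<open>second_primitive_gronwall\<close>). Hence $\dim M^\perp \le 2n$.

  Let $A$ be a self-adjoint extension. Its range contains the closed subspace $M$ of finite
  codimension, so it is closed and of finite codimension itself. Its kernel is orthogonal to its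
  range, hence lies in $M^\perp$ (\<open>fredholm_self_adjoint_extension\<close>).
\<close>

section \<open>Closed and finite-dimensional subspaces of an inner product space\<close>

lemma nearest_point_orthogonal:
  fixes x :: "'a::real_inner"
  assumes M: "subspace M" and m: "m \<in> M"
    and min: "\<And>y. y \<in> M \<Longrightarrow> norm (x - m) \<le> norm (x - y)"
    and y: "y \<in> M"
  shows "(x - m) \<bullet> y = 0"
proof (cases "y = 0")
  case False
  define c where "c = ((x - m) \<bullet> y) / (y \<bullet> y)"
  have yy: "y \<bullet> y > 0"
    using False by simp
  have "m + c *\<^sub>R y \<in> M"
    using M m y by (simp add: subspace_add subspace_scale)
  then have "(norm (x - m))\<^sup>2 \<le> (norm (x - (m + c *\<^sub>R y)))\<^sup>2"
    using min by (simp add: power_mono)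
  also have "x - (m + c *\<^sub>R y) = (x - m) - c *\<^sub>R y"
    by simp
  also have "(norm ((x - m) - c *\<^sub>R y))\<^sup>2 = (norm (x - m))\<^sup>2 - 2 * c * ((x - m) \<bullet> y) + c\<^sup>2 * (y \<bullet> y)"
    unfolding power2_norm_eq_inner
    by (simp add: inner_diff_left inner_diff_right inner_commute algebra_simps power2_eq_square)
  also have "\<dots> = (norm (x - m))\<^sup>2 - ((x - m) \<bullet> y)\<^sup>2 / (y \<bullet> y)"
    using yy by (simp add: c_def field_simps power2_eq_square)
  finally have "((x - m) \<bullet> y)\<^sup>2 / (y \<bullet> y) \<le> 0"
    by simp
  then have "((x - m) \<bullet> y)\<^sup>2 \<le> 0"
    using yy by (simp add: divide_le_0_iff)
  then show ?thesis
    by simp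
qed simp

lemma orthogonal_projection_exists:
  fixes M :: "'a::real_inner set"
  assumes M: "subspace M" and compl: "complete M"
  shows "\<exists>m\<in>M. \<forall>y\<in>M. (x - m) \<bullet> y = 0"
proof -
  have ne: "M \<noteq> {}"
    using M subspace_0 by blast
  define d where "d = infdist x M"
  have d: "d \<le> norm (x - y)" if "y \<in> M" for y
    unfolding d_def using infdist_le[OF that, of x] by (simp add: dist_norm)
  have "\<exists>y\<in>M. norm (x - y) < d + 1 / real (Suc k)" for k
  proof -
    have "infdist x M < d + 1 / real (Suc k)"
      by (simp add: d_def)
    then show ?thesis
      using ne by (subst (asm) infdist_notempty, simp, subst (asm) cINF_less_iff)
        (auto simp: dist_norm intro!: bdd_belowI[of _ 0])
  qed
  then obtain Y where Y: "\<And>k. Y k \<in> M" "\<And>k. norm (x - Y k) < d + 1 / real (Suc k)"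
    by metis
  have d0: "0 \<le> d"
    by (simp add: d_def infdist_nonneg)
  \<comment> \<open>The parallelogram law, applied to a minimising sequence, makes it a Cauchy sequence.\<close>
  have par: "(norm (Y j - Y k))\<^sup>2 \<le> 2 * ((norm (x - Y j))\<^sup>2 - d\<^sup>2) + 2 * ((norm (x - Y k))\<^sup>2 - d\<^sup>2)" for j k
  proof -
    have "(1/2) *\<^sub>R (Y j + Y k) \<in> M"
      using M Y(1) by (simp add: subspace_add subspace_scale)
    then have "d\<^sup>2 \<le> (norm (x - (1/2) *\<^sub>R (Y j + Y k)))\<^sup>2"
      using d d0 by (simp add: power_mono)
    moreover have "(norm (Y j - Y k))\<^sup>2 + 4 * (norm (x - (1/2) *\<^sub>R (Y j + Y k)))\<^sup>2
        = 2 * (norm (x - Y j))\<^sup>2 + 2 * (norm (x - Y k))\<^sup>2"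
      unfolding power2_norm_eq_inner
      by (simp add: inner_diff_left inner_diff_right inner_add_left inner_add_right
          inner_commute algebra_simps)
    ultimately show ?thesis
      by simp
  qed
  have lim: "(\<lambda>k. norm (x - Y k)) \<longlonglongrightarrow> d"
  proof (rule tendsto_sandwich)
    show "\<forall>\<^sub>F k in sequentially. d \<le> norm (x - Y k)"
      using d Y(1) by simp
    show "\<forall>\<^sub>F k in sequentially. norm (x - Y k) \<le> d + 1 / real (Suc k)"
      using Y(2) by (simp add: less_imp_le)
    show "(\<lambda>k. d + 1 / real (Suc k)) \<longlonglongrightarrow> d"
      using tendsto_add[OF tendsto_const LIMSEQ_inverse_real_of_nat, of d]
      by (simp add: inverse_eq_divide)
  qed simp
  have "Cauchy Y"
  proof (rule metric_CauchyI)
    fix e :: real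
    assume e: "0 < e"
    have "(\<lambda>k. (norm (x - Y k))\<^sup>2 - d\<^sup>2) \<longlonglongrightarrow> d\<^sup>2 - d\<^sup>2"
      by (intro tendsto_intros lim)
    then have "\<forall>\<^sub>F k in sequentially. (norm (x - Y k))\<^sup>2 - d\<^sup>2 < e\<^sup>2 / 4"
      using e by (intro order_tendstoD(2)) auto
    then obtain K where K: "\<And>k. k \<ge> K \<Longrightarrow> (norm (x - Y k))\<^sup>2 - d\<^sup>2 < e\<^sup>2 / 4"
      by (auto simp: eventually_sequentially)
    have "dist (Y j) (Y k) < e" if "j \<ge> K" "k \<ge> K" for j k
    proof -
      have "(norm (Y j - Y k))\<^sup>2 < e\<^sup>2"
        using par[of j k] K[OF that(1)] K[OF that(2)] by argo
      then show ?thesis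
        using e by (simp add: dist_norm power_less_imp_less_base)
    qed
    then show "\<exists>K. \<forall>j\<ge>K. \<forall>k\<ge>K. dist (Y j) (Y k) < e"
      by blast
  qed
  then obtain m where m: "m \<in> M" "Y \<longlonglongrightarrow> m"
    using compl Y(1) unfolding complete_def by blast
  have "(\<lambda>k. norm (x - Y k)) \<longlonglongrightarrow> norm (x - m)"
    by (intro tendsto_intros m)
  then have "norm (x - m) = d"
    using lim LIMSEQ_unique by blast
  then show ?thesis
    using nearest_point_orthogonal[OF M m(1)] d m(1) by metis
qed

lemma orthogonal_projection_span_exists:
  fixes B :: "'a::real_inner set"
  assumes "finite B"
  shows "\<exists>m\<in>span B. \<forall>y\<in>span B. (x - m) \<bullet> y = 0"
proof -
  obtain C where C: "finite C" "span C = span B" "pairwise orthogonal C"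
    using basis_orthogonal[OF assms] by blast
  define m where "m = (\<Sum>c\<in>C. ((x \<bullet> c) / (c \<bullet> c)) *\<^sub>R c)"
  have "m \<in> span C"
    unfolding m_def by (intro span_sum span_scale span_base)
  moreover have "(x - m) \<bullet> c = 0" if c: "c \<in> C" for c
  proof -
    have "m \<bullet> c = (\<Sum>b\<in>C. ((x \<bullet> b) / (b \<bullet> b)) * (b \<bullet> c))"
      by (simp add: m_def inner_sum_left)
    also have "\<dots> = (\<Sum>b\<in>C. if b = c then x \<bullet> c else 0)"
    proof (intro sum.cong refl)
      fix b
      assume "b \<in> C"
      then have "b \<noteq> c \<Longrightarrow> b \<bullet> c = 0"
        using C(3) c by (auto simp: pairwise_def orthogonal_def)
      then show "((x \<bullet> b) / (b \<bullet> b)) * (b \<bullet> c) = (if b = c then x \<bullet> c else 0)"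
        by auto
    qed
    also have "\<dots> = x \<bullet> c"
      using C(1) c by simp
    finally show ?thesis
      by (simp add: inner_diff_left)
  qed
  then have "(x - m) \<bullet> y = 0" if "y \<in> span C" for y
    using that orthogonal_to_span[of y C "x - m"] by (simp add: orthogonal_def)
  ultimately show ?thesis
    using C(2) by blast
qed

lemma finite_dim_subspace:
  assumes S: "subspace S" "S \<subseteq> span B" and B: "finite B"
  shows "finite_dim S"
proof -
  obtain C where C: "C \<subseteq> S" "independent C" "S \<subseteq> span C"
    using maximal_independent_subset by blast
  then have "finite C"
    using independent_span_bound[OF B C(2)] S(2) by blast
  moreover have "span C = S"
    using C S(1) by (metis span_mono span_eq_iff subset_antisym)
  ultimately show ?thesis
    by (auto simp: finite_dim_def)
qed

lemma closure_subspace: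
  fixes S :: "'a::real_normed_vector set"
  assumes S: "subspace S"
  shows "subspace (closure S)"
proof (rule subspaceI)
  show "0 \<in> closure S"
    using subspace_0[OF S] closure_subset by blast
next
  fix x y
  assume "x \<in> closure S" "y \<in> closure S"
  then obtain X Y where "\<And>k. X k \<in> S" "X \<longlonglongrightarrow> x" "\<And>k. Y k \<in> S" "Y \<longlonglongrightarrow> y"
    unfolding closure_sequential by blast
  then have "\<forall>k. X k + Y k \<in> S" "(\<lambda>k. X k + Y k) \<longlonglongrightarrow> x + y"
    using S by (auto intro: subspace_add tendsto_add)
  then show "x + y \<in> closure S"
    unfolding closure_sequential by (intro exI[of _ "\<lambda>k. X k + Y k"]) blast
next
  fix c x
  assume "x \<in> closure S"
  then obtain X where "\<And>k. X k \<in> S" "X \<longlonglongrightarrow> x"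
    unfolding closure_sequential by blast
  then have "\<forall>k. c *\<^sub>R X k \<in> S" "(\<lambda>k. c *\<^sub>R X k) \<longlonglongrightarrow> c *\<^sub>R x"
    using S by (auto intro: subspace_scale tendsto_scaleR)
  then show "c *\<^sub>R x \<in> closure S"
    unfolding closure_sequential by (intro exI[of _ "\<lambda>k. c *\<^sub>R X k"]) blast
qed

lemma subspace_orthogonal_complement:
  fixes V :: "'a::real_inner set"
  shows "subspace {x. \<forall>y\<in>V. x \<bullet> y = 0}"
  by (auto simp: subspace_def inner_add_left)

lemma closed_orthogonal_complement:
  fixes V :: "'a::real_inner set"
  shows "closed {x. \<forall>y\<in>V. x \<bullet> y = 0}"
proof -
  have "{x. \<forall>y\<in>V. x \<bullet> y = 0} = (\<Inter>y\<in>V. {x. x \<bullet> y = 0})"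
    by auto
  then show ?thesis
    by (auto intro!: closed_INT closed_Collect_eq continuous_intros)
qed

text \<open>
  A subspace \<^term>\<open>V\<close> that contains a complete \<^term>\<open>M\<close> with finite-dimensional complement
  equals its own double orthogonal complement, which is closed: modulo \<^term>\<open>M\<close> a vector of the
  double complement lies in the finite-dimensional space $M^\perp$, where it can be projected onto
  $V \cap M^\perp$, and the remainder is orthogonal to itself.
\<close>

lemma closed_of_finite_codim:
  fixes V :: "'a::real_inner set"
  assumes V: "subspace V" and M: "subspace M" "complete M" "M \<subseteq> V"
    and fin: "finite_dim {x. \<forall>y\<in>M. x \<bullet> y = 0}"
  shows "closed V" and "finite_codim V"
proof -
  define N where "N = {x. \<forall>y\<in>M. x \<bullet> y = 0}"
  obtain B where B: "finite B" "span B = N"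
    using fin unfolding finite_dim_def N_def by blast
  have proj: "\<exists>m\<in>M. x - m \<in> N" for x
    using orthogonal_projection_exists[OF M(1,2), of x] by (auto simp: N_def)
  have N: "subspace N"
    unfolding N_def by (rule subspace_orthogonal_complement)
  show "finite_codim V"
    unfolding finite_codim_def
  proof (intro exI[of _ B] conjI allI)
    fix x
    obtain m where "m \<in> M" "x - m \<in> N"
      using proj by blast
    then show "\<exists>b\<in>span B. x - b \<in> V"
      using B(2) M(3) by (intro bexI[of _ "x - m"]) auto
  qed (rule B)
  define W where "W = {x. \<forall>y\<in>V. x \<bullet> y = 0}"
  have "finite_dim (V \<inter> N)"
    using B V N by (intro finite_dim_subspace[of _ B] subspace_inter) auto
  then obtain C where C: "finite C" "span C = V \<inter> N"
    by (auto simp: finite_dim_def)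
  have "V = {x. \<forall>y\<in>W. x \<bullet> y = 0}"
  proof (intro equalityI subsetI)
    fix x
    assume "x \<in> {x. \<forall>y\<in>W. x \<bullet> y = 0}"
    then have x: "\<And>y. y \<in> W \<Longrightarrow> x \<bullet> y = 0"
      by blast
    obtain m where m: "m \<in> M" "x - m \<in> N"
      using proj by blast
    obtain q where q: "q \<in> V \<inter> N" "\<And>y. y \<in> V \<inter> N \<Longrightarrow> (x - m - q) \<bullet> y = 0"
      using orthogonal_projection_span_exists[OF C(1), of "x - m"] C(2) by auto
    have mqV: "m \<in> V" "q \<in> V" "m + q \<in> V"
      using m q M(3) V by (auto intro: subspace_add)
    have rN: "x - m - q \<in> N"
      using m q N by (simp add: subspace_diff)
    have "(x - m - q) \<bullet> v = 0" if v: "v \<in> V" for v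
    proof -
      obtain k where k: "k \<in> M" "v - k \<in> N"
        using proj by blast
      then have "v - k \<in> V \<inter> N"
        using v M(3) V by (auto intro: subspace_diff)
      then have "(x - m - q) \<bullet> (v - k) = 0"
        by (rule q(2))
      moreover have "(x - m - q) \<bullet> k = 0"
        using rN k(1) by (simp add: N_def)
      ultimately show ?thesis
        by (simp add: inner_diff_right)
    qed
    then have r: "x - m - q \<in> W"
      by (simp add: W_def)
    have "(x - m - q) \<bullet> (x - m - q) = x \<bullet> (x - m - q) - (x - m - q) \<bullet> (m + q)"
      by (simp add: algebra_simps inner_commute)
    also have "\<dots> = 0"
      using x[OF r] r mqV(3) by (simp add: W_def)
    finally have "x - m - q = 0"
      by simp
    then have "x = m + q"
      by (simp add: algebra_simps)
    then show "x \<in> V"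
      using mqV(3) by simp
  qed (auto simp: W_def inner_commute)
  then show "closed V"
    using closed_orthogonal_complement[of W] by simp
qed

text \<open>
  The second components parametrise \<^term>\<open>S\<close> faithfully, so a basis of \<^term>\<open>S\<close> has no more
  elements than the dimension of the parameter space.
\<close>

lemma finite_dim_of_parametrised:
  fixes S :: "('a::real_vector \<times> 'b::euclidean_space) set"
  assumes S: "subspace S" and inj: "\<And>x. (x, 0) \<in> S \<Longrightarrow> x = 0"
    and N: "subspace N" "N \<subseteq> fst ` S"
  shows "finite_dim N"
proof -
  obtain C where C: "C \<subseteq> S" "independent C" "S \<subseteq> span C"
    using maximal_independent_subset by blast
  have span: "span C = S"
    using C S by (metis span_mono span_eq_iff subset_antisym)
  have "inj_on snd (span C)"
  proof (rule inj_onI)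
    fix p q
    assume pq: "p \<in> span C" "q \<in> span C" "snd p = snd q"
    then have "p - q \<in> S"
      using S by (simp add: span subspace_diff)
    moreover have "p - q = (fst p - fst q, 0)"
      using pq(3) by (simp add: prod_eq_iff)
    ultimately have "fst p - fst q = 0"
      using inj by metis
    then show "p = q"
      using pq(3) by (simp add: prod_eq_iff)
  qed
  then have "independent (snd ` C)"
    using C(2) by (intro linear_independent_injective_image) (auto intro: linear_snd)
  then have "finite (snd ` C)"
    using independent_imp_finite by blast
  moreover have "inj_on snd C"
    using \<open>inj_on snd (span C)\<close> inj_on_subset span_superset by blast
  ultimately have "finite C"
    using finite_imageD by blast
  moreover have "fst ` S = span (fst ` C)"
    using linear_span_image[OF linear_fst, of C] span by simp
  ultimately show ?thesis
    using N by (intro finite_dim_subspace[of N "fst ` C"]) auto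
qed


section \<open>Completeness of the space of square-integrable functions\<close>

lemma L2_rel_refl: "square_integrable f \<Longrightarrow> L2_rel f f"
  by (simp add: L2_rel_def)

lemma to_L2_add:
  "square_integrable f \<Longrightarrow> square_integrable g \<Longrightarrow> to_L2 f + to_L2 g = to_L2 (\<lambda>t. f t + g t)"
  by (simp add: plus_L2.abs_eq L2_rel_refl)

lemma to_L2_diff:
  "square_integrable f \<Longrightarrow> square_integrable g \<Longrightarrow> to_L2 f - to_L2 g = to_L2 (\<lambda>t. f t - g t)"
  by (simp add: minus_L2.abs_eq L2_rel_refl)

lemma to_L2_scaleR: "square_integrable f \<Longrightarrow> c *\<^sub>R to_L2 f = to_L2 (\<lambda>t. c *\<^sub>R f t)"
  by (simp add: scaleR_L2.abs_eq L2_rel_refl)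

lemma to_L2_zero: "to_L2 (\<lambda>_. 0) = 0"
  by (simp add: zero_L2_def)

lemma inner_to_L2:
  "square_integrable f \<Longrightarrow> square_integrable g \<Longrightarrow> to_L2 f \<bullet> to_L2 g = (LINT t|I01. f t \<bullet> g t)"
  by (simp add: inner_L2.abs_eq L2_rel_refl)

lemma norm_to_L2:
  assumes "square_integrable f"
  shows "(norm (to_L2 f))\<^sup>2 = (LINT t|I01. (norm (f t))\<^sup>2)"
  using inner_to_L2[OF assms assms] by (simp add: power2_norm_eq_inner)

lemma to_L2_cong:
  assumes "square_integrable f" "square_integrable g" "AE t in I01. f t = g t"
  shows "to_L2 f = to_L2 g"
  using assms by (simp add: Quotient3_rel_abs[OF Quotient3_L2] L2_rel_def)

lemma square_integrable_rep_L2: "square_integrable (rep_L2 x)"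
  using Quotient3_rep_reflp[OF Quotient3_L2, of x] by (simp add: L2_rel_def)

lemma to_L2_rep_L2: "to_L2 (rep_L2 x) = x"
  by (rule Quotient3_abs_rep[OF Quotient3_L2])

lemma finite_measure_I01: "finite_measure I01"
  by (rule finite_measureI) (simp add: emeasure_restrict_space)

lemma measure_I01: "measure I01 (space I01) = 1"
  by (simp add: measure_restrict_space)

lemma square_integrable_const: "square_integrable (\<lambda>_. c)"
  using finite_measure_I01 by (simp add: square_integrable_def finite_measure.integrable_const)

lemma square_integrable_norm: "square_integrable f \<Longrightarrow> square_integrable (\<lambda>t. norm (f t))"
  by (auto simp: square_integrable_def)

lemma square_integrable_integrable:
  fixes f :: "real \<Rightarrow> 'a::euclidean_space"
  assumes "square_integrable f"
  shows "integrable I01 f"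
proof -
  have "integrable I01 (\<lambda>t. norm (f t) \<bullet> (1::real))"
    by (intro square_integrable_inner square_integrable_norm square_integrable_const assms)
  then show ?thesis
    using assms by (simp add: square_integrable_def integrable_norm_iff)
qed

lemma LINT_norm_le_norm_L2:
  assumes f: "square_integrable f"
  shows "(LINT t|I01. norm (f t)) \<le> norm (to_L2 f)"
proof -
  note n = square_integrable_norm[OF f]
  have norm_f: "norm (to_L2 (\<lambda>t. norm (f t))) = norm (to_L2 f)"
    using norm_to_L2[OF n] norm_to_L2[OF f]
    by (simp add: power2_eq_imp_eq)
  have "(norm (to_L2 (\<lambda>_. 1::real)))\<^sup>2 = measure I01 (space I01)"
    unfolding norm_to_L2[OF square_integrable_const] by simp
  then have "(norm (to_L2 (\<lambda>_. 1::real)))\<^sup>2 = 1\<^sup>2"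
    unfolding measure_I01 by simp
  then have norm_1: "norm (to_L2 (\<lambda>_. 1::real)) = 1"
    by (rule power2_eq_imp_eq) simp_all
  have "(LINT t|I01. norm (f t)) = to_L2 (\<lambda>t. norm (f t)) \<bullet> to_L2 (\<lambda>_. 1::real)"
    by (subst inner_to_L2[OF n square_integrable_const]) simp
  also have "\<dots> \<le> norm (to_L2 (\<lambda>t. norm (f t))) * norm (to_L2 (\<lambda>_. 1::real))"
    by (rule norm_cauchy_schwarz)
  finally show ?thesis
    unfolding norm_f norm_1 by simp
qed

text \<open>
  A Cauchy sequence in $L^2$ is Cauchy in $L^1$, since the interval has finite measure. Along a
  subsequence it therefore converges almost everywhere, and Fatou's lemma turns the pointwise limit
  into the limit in $L^2$.
\<close>

instance L2 :: (euclidean_space) complete_space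
proof
  fix X :: "nat \<Rightarrow> 'a L2"
  assume X: "Cauchy X"
  define f where "f = (\<lambda>k. rep_L2 (X k))"
  have f: "square_integrable (f k)" "to_L2 (f k) = X k" for k
    by (simp_all add: f_def square_integrable_rep_L2 to_L2_rep_L2)
  have meas [measurable]: "f k \<in> borel_measurable I01" for k
    using f(1) by (rule square_integrable_measurable)
  have dist: "to_L2 (\<lambda>t. f i t - f j t) = X i - X j" for i j
    using to_L2_diff[OF f(1) f(1)] f(2) by metis
  have "\<exists>N. \<forall>i\<ge>N. \<forall>j\<ge>N. (LINT t|I01. norm (f i t - f j t)) < e" if "e > 0" for e :: real
  proof -
    obtain N where N: "\<And>i j. i \<ge> N \<Longrightarrow> j \<ge> N \<Longrightarrow> norm (X i - X j) < e"
      using CauchyD[OF X \<open>e > 0\<close>] by blast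
    have "(LINT t|I01. norm (f i t - f j t)) \<le> norm (X i - X j)" for i j
      using LINT_norm_le_norm_L2[OF square_integrable_diff[OF f(1) f(1)], of i j] dist by metis
    then show ?thesis
      using N by (meson le_less_trans)
  qed
  then obtain r where r: "strict_mono r" "AE t in I01. Cauchy (\<lambda>k. f (r k) t)"
    using cauchy_L1_AE_cauchy_subseq[of I01 f] square_integrable_integrable[OF f(1)] by blast
  define g where "g = (\<lambda>t. lim (\<lambda>k. f (r k) t))"
  have g [measurable]: "g \<in> borel_measurable I01"
    unfolding g_def by (rule borel_measurable_lim_metric) simp
  have lim: "AE t in I01. (\<lambda>k. f (r k) t) \<longlonglongrightarrow> g t"
    using r(2) by eventually_elim (simp add: g_def Cauchy_convergent_iff convergent_LIMSEQ_iff)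
  have fatou: "(\<integral>\<^sup>+t. ennreal ((norm (f i t - g t))\<^sup>2) \<partial>I01) \<le> ennreal (e\<^sup>2)"
    if e: "e > 0" and N: "\<forall>j\<ge>N. norm (X i - X j) < e" for e i N
  proof -
    have "(\<integral>\<^sup>+t. ennreal ((norm (f i t - g t))\<^sup>2) \<partial>I01)
        = (\<integral>\<^sup>+t. liminf (\<lambda>k. ennreal ((norm (f i t - f (r k) t))\<^sup>2)) \<partial>I01)"
    proof (rule nn_integral_cong_AE)
      show "AE t in I01. ennreal ((norm (f i t - g t))\<^sup>2)
          = liminf (\<lambda>k. ennreal ((norm (f i t - f (r k) t))\<^sup>2))"
        using lim
      proof eventually_elim
        case (elim t)
        then have "(\<lambda>k. ennreal ((norm (f i t - f (r k) t))\<^sup>2)) \<longlonglongrightarrow> ennreal ((norm (f i t - g t))\<^sup>2)"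
          by (intro tendsto_intros tendsto_ennrealI)
        then show ?case
          using lim_imp_Liminf[OF sequentially_bot] by metis
      qed
    qed
    also have "\<dots> \<le> liminf (\<lambda>k. \<integral>\<^sup>+t. ennreal ((norm (f i t - f (r k) t))\<^sup>2) \<partial>I01)"
      by (rule nn_integral_liminf) simp
    also have "\<dots> \<le> liminf (\<lambda>k::nat. ennreal (e\<^sup>2))"
    proof (rule Liminf_mono)
      have "(\<integral>\<^sup>+t. ennreal ((norm (f i t - f (r k) t))\<^sup>2) \<partial>I01) \<le> ennreal (e\<^sup>2)" if "k \<ge> N" for k
      proof -
        have "N \<le> r k"
          using that seq_suble[OF r(1), of k] by simp
        then have "(norm (X i - X (r k)))\<^sup>2 \<le> e\<^sup>2"
          using N e by (intro power_mono) (auto intro: less_imp_le)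
        moreover have sq: "square_integrable (\<lambda>t. f i t - f (r k) t)"
          by (intro square_integrable_diff f)
        then have "(\<integral>\<^sup>+t. ennreal ((norm (f i t - f (r k) t))\<^sup>2) \<partial>I01) = ennreal ((norm (X i - X (r k)))\<^sup>2)"
          using norm_to_L2[OF sq] dist
          by (subst nn_integral_eq_integral) (auto simp: square_integrable_def)
        ultimately show ?thesis
          by (simp add: ennreal_leI)
      qed
      then show "\<forall>\<^sub>F k in sequentially.
          (\<integral>\<^sup>+t. ennreal ((norm (f i t - f (r k) t))\<^sup>2) \<partial>I01) \<le> ennreal (e\<^sup>2)"
        by (auto simp: eventually_sequentially)
    qed
    finally show ?thesis
      by (simp add: Liminf_const)
  qed
  have sq: "square_integrable (\<lambda>t. f i t - g t)"
    if "e > 0" "\<forall>j\<ge>N. norm (X i - X j) < e" for e i N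
    unfolding square_integrable_def
  proof
    show "integrable I01 (\<lambda>t. (norm (f i t - g t))\<^sup>2)"
      using fatou[OF that] by (intro integrableI_bounded) (auto intro: le_less_trans)
  qed simp
  obtain N0 where N0: "\<And>i j. i \<ge> N0 \<Longrightarrow> j \<ge> N0 \<Longrightarrow> norm (X i - X j) < 1"
    using CauchyD[OF X, of 1] by auto
  have "square_integrable (\<lambda>t. f N0 t - (f N0 t - g t))"
    using N0 by (intro square_integrable_diff f sq[of 1 N0]) auto
  then have gsq: "square_integrable g"
    by simp
  have "X \<longlonglongrightarrow> to_L2 g"
  proof (rule LIMSEQ_I)
    fix e :: real
    assume "e > 0"
    then have e: "e / 2 > 0"
      by simp
    obtain N where N: "\<And>i j. i \<ge> N \<Longrightarrow> j \<ge> N \<Longrightarrow> norm (X i - X j) < e / 2"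
      using CauchyD[OF X e] by blast
    have "norm (X i - to_L2 g) < e" if i: "i \<ge> N" for i
    proof -
      have s: "square_integrable (\<lambda>t. f i t - g t)"
        by (intro square_integrable_diff f gsq)
      have "ennreal ((norm (X i - to_L2 g))\<^sup>2) = (\<integral>\<^sup>+t. ennreal ((norm (f i t - g t))\<^sup>2) \<partial>I01)"
        using norm_to_L2[OF s] to_L2_diff[OF f(1) gsq, of i] f(2)[of i] s
        by (subst nn_integral_eq_integral) (auto simp: square_integrable_def)
      also have "\<dots> \<le> ennreal ((e / 2)\<^sup>2)"
        using i N by (intro fatou[OF e, of N]) auto
      finally have "norm (X i - to_L2 g) \<le> e / 2"
        using e by (simp add: power_mono_iff)
      then show ?thesis
        using \<open>e > 0\<close> by simp
    qed
    then show "\<exists>N. \<forall>i\<ge>N. norm (X i - to_L2 g) < e"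
      by blast
  qed
  then show "convergent X"
    by (auto simp: convergent_def)
qed


section \<open>Smooth functions of one variable\<close>

definition smooth :: "(real \<Rightarrow> 'a::real_normed_vector) \<Rightarrow> bool"
  where "smooth f \<longleftrightarrow> (\<forall>k t. iter_deriv k f differentiable (at t))"

lemma iter_deriv_0 [simp]: "iter_deriv 0 f = f"
  by (simp add: iter_deriv_def)

lemma iter_deriv_Suc: "iter_deriv (Suc k) f = (\<lambda>t. vector_derivative (iter_deriv k f) (at t))"
  by (simp add: iter_deriv_def)

lemma iter_deriv_Suc_shift:
  assumes "\<And>t. (f has_vector_derivative f' t) (at t)"
  shows "iter_deriv (Suc k) f = iter_deriv k f'"
proof -
  have "(\<lambda>t. vector_derivative f (at t)) = f'"
    using assms by (auto intro: vector_derivative_at)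
  then show ?thesis
    by (simp add: iter_deriv_def funpow_swap1 del: funpow.simps)
      (simp add: funpow_Suc_right del: funpow.simps)
qed

lemma smooth_deriv:
  assumes "smooth f"
  shows "(iter_deriv k f has_vector_derivative iter_deriv (Suc k) f t) (at t)"
  using assms by (simp add: smooth_def iter_deriv_Suc vector_derivative_works)

lemma smooth_iter_deriv:
  assumes "smooth f"
  shows "smooth (iter_deriv k f)"
  using assms by (auto simp: smooth_def iter_deriv_def funpow_add[symmetric, unfolded o_def, THEN fun_cong]
      simp del: funpow.simps)

text \<open>
  Smoothness is coinductive: a class of functions closed under differentiation consists of smooth
  functions.
\<close>

lemma smooth_coinduct:
  assumes "f \<in> C" and C: "\<And>g. g \<in> C \<Longrightarrow> \<exists>g'\<in>C. \<forall>t. (g has_vector_derivative g' t) (at t)"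
  shows "smooth f"
proof -
  have "iter_deriv k f \<in> C" for k
  proof (induction k)
    case (Suc k)
    then obtain g' where g': "g' \<in> C" "\<And>t. (iter_deriv k f has_vector_derivative g' t) (at t)"
      using C by blast
    then have "iter_deriv (Suc k) f = g'"
      by (auto simp: iter_deriv_Suc intro: vector_derivative_at)
    with g' show ?case
      by simp
  qed (use assms in simp)
  then show ?thesis
    unfolding smooth_def using C by (meson differentiableI_vector)
qed

inductive_set function_algebra :: "(real \<Rightarrow> real) set \<Rightarrow> (real \<Rightarrow> real) set"
  for G where
  gen: "f \<in> G \<Longrightarrow> f \<in> function_algebra G"
| const: "(\<lambda>_. c) \<in> function_algebra G"
| add: "f \<in> function_algebra G \<Longrightarrow> g \<in> function_algebra G \<Longrightarrow> (\<lambda>t. f t + g t) \<in> function_algebra G"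
| mult: "f \<in> function_algebra G \<Longrightarrow> g \<in> function_algebra G \<Longrightarrow> (\<lambda>t. f t * g t) \<in> function_algebra G"

text \<open>
  By the sum and product rules an algebra of functions is closed under differentiation as soon as it
  contains the derivatives of its generators. This replaces Leibniz' formula.
\<close>

lemma smooth_function_algebra:
  assumes G: "\<And>g. g \<in> G \<Longrightarrow> \<exists>g'\<in>function_algebra G. \<forall>t. (g has_vector_derivative g' t) (at t)"
    and f: "f \<in> function_algebra G"
  shows "smooth f"
proof (rule smooth_coinduct[OF f])
  fix g
  assume "g \<in> function_algebra G"
  then show "\<exists>g'\<in>function_algebra G. \<forall>t. (g has_vector_derivative g' t) (at t)"
  proof induction
    case (gen g)
    then show ?case by (rule G)
  next
    case (const c)
    show ?case
      by (rule bexI[of _ "\<lambda>_. 0"]) (auto intro: function_algebra.const)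
  next
    case (add f g)
    then obtain f' g' where "f' \<in> function_algebra G" "g' \<in> function_algebra G"
      "\<And>t. (f has_vector_derivative f' t) (at t)" "\<And>t. (g has_vector_derivative g' t) (at t)"
      by blast
    then show ?case
      by (intro bexI[of _ "\<lambda>t. f' t + g' t"])
        (auto intro: has_vector_derivative_add function_algebra.add)
  next
    case (mult f g)
    then obtain f' g' where "f' \<in> function_algebra G" "g' \<in> function_algebra G"
      "\<And>t. (f has_vector_derivative f' t) (at t)" "\<And>t. (g has_vector_derivative g' t) (at t)"
      by blast
    with mult.hyps show ?case
      by (intro bexI[of _ "\<lambda>t. f t * g' t + f' t * g t"])
        (auto intro: has_vector_derivative_mult function_algebra.add function_algebra.mult)
  qed
qed

lemma smooth_linear_combination:
  assumes f: "smooth f" and g: "smooth g"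
  shows "smooth (\<lambda>t. a *\<^sub>R f t + b *\<^sub>R g t)"
    and "iter_deriv k (\<lambda>t. a *\<^sub>R f t + b *\<^sub>R g t)
      = (\<lambda>t. a *\<^sub>R iter_deriv k f t + b *\<^sub>R iter_deriv k g t)"
proof -
  have D: "((\<lambda>t. a *\<^sub>R iter_deriv k f t + b *\<^sub>R iter_deriv k g t) has_vector_derivative
      a *\<^sub>R iter_deriv (Suc k) f t + b *\<^sub>R iter_deriv (Suc k) g t) (at t)" for k t
    using smooth_deriv[OF f, of k t] smooth_deriv[OF g, of k t] by (auto intro!: derivative_eq_intros)
  show *: "iter_deriv k (\<lambda>t. a *\<^sub>R f t + b *\<^sub>R g t)
      = (\<lambda>t. a *\<^sub>R iter_deriv k f t + b *\<^sub>R iter_deriv k g t)" for k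
  proof (induction k)
    case (Suc k)
    then show ?case
      using D[of k] by (auto simp: iter_deriv_Suc[of k "\<lambda>t. a *\<^sub>R f t + b *\<^sub>R g t"]
          intro!: vector_derivative_at)
  qed simp
  show "smooth (\<lambda>t. a *\<^sub>R f t + b *\<^sub>R g t)"
    unfolding smooth_def * using D by (meson differentiableI_vector)
qed

text \<open>
  Adjoining one primitive to the class of smooth functions keeps it closed under differentiation.
\<close>

lemma smooth_antiderivative:
  assumes g: "smooth g" and f: "\<And>t. (f has_vector_derivative g t) (at t)"
  shows "smooth f"
proof (rule smooth_coinduct[of _ "insert f {g. smooth g}"])
  fix h
  assume "h \<in> insert f {g. smooth g}"
  then show "\<exists>h'\<in>insert f {g. smooth g}. \<forall>t. (h has_vector_derivative h' t) (at t)"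
    using f g smooth_deriv[of h 0] smooth_iter_deriv[of h 1] by auto
qed simp

lemma smooth_scaleR_vector:
  fixes f :: "real \<Rightarrow> real" and e :: "'a::real_normed_vector"
  assumes f: "smooth f"
  shows "smooth (\<lambda>t. f t *\<^sub>R e)" and "iter_deriv k (\<lambda>t. f t *\<^sub>R e) = (\<lambda>t. iter_deriv k f t *\<^sub>R e)"
proof -
  have D: "((\<lambda>t. iter_deriv k f t *\<^sub>R e) has_vector_derivative iter_deriv (Suc k) f t *\<^sub>R e) (at t)" for k t
    using has_vector_derivative_scaleR[OF smooth_deriv[OF f, of k t, folded has_real_derivative_iff_has_vector_derivative]
        has_vector_derivative_const[of e]] by simp
  show *: "iter_deriv k (\<lambda>t. f t *\<^sub>R e) = (\<lambda>t. iter_deriv k f t *\<^sub>R e)" for k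
  proof (induction k)
    case (Suc k)
    then show ?case
      using D[of k] by (auto simp: iter_deriv_Suc[of k "\<lambda>t. f t *\<^sub>R e"] intro!: vector_derivative_at)
  qed simp
  show "smooth (\<lambda>t. f t *\<^sub>R e)"
    unfolding smooth_def * using D by (meson differentiableI_vector)
qed

section \<open>Bump functions\<close>

text \<open>
  For $n = 0$ this is the classical function that vanishes to infinite order at 0. The negative powers
  of $x$ are the factors that appear when it is differentiated.
\<close>

definition flat_power :: "nat \<Rightarrow> real \<Rightarrow> real"
  where "flat_power n x = (if x > 0 then inverse x ^ n * exp (- inverse x) else 0)"

lemma flat_power_deriv:
  "(flat_power n has_real_derivative flat_power (n + 2) x - real n * flat_power (n + 1) x) (at x)"
proof -
  consider "x < 0" | "x = 0" | "x > 0"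
    by linarith
  then show ?thesis
  proof cases
    assume x: "x < 0"
    have "((\<lambda>_. 0) has_real_derivative 0) (at x)"
      by simp
    then have "(flat_power n has_real_derivative 0) (at x)"
      by (rule DERIV_cong_ev[OF refl _ refl, THEN iffD1, rotated])
        (use x eventually_at_filter in \<open>auto simp: flat_power_def eventually_nhds
          intro!: exI[of _ "{..<0}"]\<close>)
    then show ?thesis
      using x by (simp add: flat_power_def)
  next
    assume x: "x = 0"
    (* For h > 0 the difference quotient is h^-(n+1) exp (-1/h), and the exponential wins. *)
    have "((\<lambda>y::real. y ^ Suc n / exp y) \<longlongrightarrow> 0) at_top"
      by (rule tendsto_power_div_exp_0)
    then have "((\<lambda>h. inverse h ^ Suc n / exp (inverse h)) \<longlongrightarrow> (0::real)) (at_right 0)"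
      by (rule filterlim_compose) (rule filterlim_inverse_at_top_right)
    then have "((\<lambda>h. (flat_power n (0 + h) - flat_power n 0) / h) \<longlongrightarrow> 0) (at_right 0)"
      by (rule Lim_transform_eventually)
        (auto simp: eventually_at_right_field flat_power_def exp_minus field_simps intro!: exI[of _ 1])
    moreover have "((\<lambda>h. (flat_power n (0 + h) - flat_power n 0) / h) \<longlongrightarrow> 0) (at_left 0)"
      by (rule Lim_transform_eventually[OF tendsto_const])
        (auto simp: eventually_at_left_field flat_power_def intro!: exI[of _ "-1"])
    ultimately have "(flat_power n has_real_derivative 0) (at 0)"
      unfolding DERIV_def by (simp add: filterlim_split_at)
    then show ?thesis
      using x by (simp add: flat_power_def)
  next
    assume x: "x > 0"
    have "((\<lambda>x. inverse x ^ n * exp (- inverse x)) has_real_derivative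
        flat_power (n + 2) x - real n * flat_power (n + 1) x) (at x)"
      using x by (auto intro!: derivative_eq_intros simp: flat_power_def field_simps power2_eq_square)
        (cases n; simp add: field_simps)
    then show ?thesis
      by (rule DERIV_cong_ev[OF refl _ refl, THEN iffD1, rotated])
        (use x eventually_at_filter in \<open>auto simp: flat_power_def eventually_nhds
          intro!: exI[of _ "{0<..}"]\<close>)
  qed
qed

text \<open>
  The parameter \<^term>\<open>k\<close> controls the steepness. The height stays at most one while the bump fills
  the interval as \<^term>\<open>k\<close> grows, so indicators of intervals are approximated without any
  convolution.
\<close>

definition bump :: "real \<Rightarrow> real \<Rightarrow> real \<Rightarrow> real \<Rightarrow> real"
  where "bump k c d t = flat_power 0 (k * (t - c)) * flat_power 0 (k * (d - t))"

text \<open>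
  The flat functions composed with affine maps generate an algebra that contains the derivatives of
  its generators.
\<close>

lemma smooth_bump: "smooth (bump k c d)"
proof -
  define G where "G = {\<lambda>t. flat_power n (a * t + b) | n a b. True}"
  have "smooth f" if f: "f \<in> function_algebra G" for f
  proof (rule smooth_function_algebra[OF _ f])
    fix g
    assume "g \<in> G"
    then obtain n a b where g: "g = (\<lambda>t. flat_power n (a * t + b))"
      by (auto simp: G_def)
    define g' where "g' = (\<lambda>t. (\<lambda>_. a) t * (flat_power (n + 2) (a * t + b)
        + (\<lambda>_. - real n) t * flat_power (n + 1) (a * t + b)))"
    have "g' \<in> function_algebra G"
      unfolding g'_def by (intro function_algebra.mult function_algebra.add function_algebra.const)
        (auto simp: G_def intro!: function_algebra.gen)
    moreover have "(g has_vector_derivative g' t) (at t)" for t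
    proof -
      have "((\<lambda>t. a * t + b) has_real_derivative a) (at t)"
        by (auto intro!: derivative_eq_intros)
      from DERIV_chain2[OF flat_power_deriv this] show ?thesis
        by (simp add: g g'_def has_real_derivative_iff_has_vector_derivative[symmetric] algebra_simps)
    qed
    ultimately show "\<exists>g'\<in>function_algebra G. \<forall>t. (g has_vector_derivative g' t) (at t)"
      by blast
  qed
  moreover have "(\<lambda>t. flat_power n (a * t + b)) \<in> function_algebra G" for n a b
    unfolding G_def by (rule function_algebra.gen) blast
  then have "(\<lambda>t. flat_power 0 (k * t + (- k * c)) * flat_power 0 ((- k) * t + k * d)) \<in> function_algebra G"
    by (intro function_algebra.mult)
  ultimately have "smooth (\<lambda>t. flat_power 0 (k * t + (- k * c)) * flat_power 0 ((- k) * t + k * d))"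
    by blast
  also have "(\<lambda>t. flat_power 0 (k * t + (- k * c)) * flat_power 0 ((- k) * t + k * d)) = bump k c d"
    by (simp add: bump_def fun_eq_iff algebra_simps)
  finally show ?thesis .
qed

lemma bump_outside: "k > 0 \<Longrightarrow> t \<notin> {c<..<d} \<Longrightarrow> bump k c d t = 0"
  by (auto simp: bump_def flat_power_def zero_less_mult_iff)

lemma bump_bounds: "0 \<le> bump k c d t" "bump k c d t \<le> 1"
proof -
  have "0 \<le> flat_power 0 x" "flat_power 0 x \<le> 1" for x
    by (simp_all add: flat_power_def)
  then show "0 \<le> bump k c d t" "bump k c d t \<le> 1"
    by (simp_all add: bump_def mult_le_one)
qed

lemma bump_pos: "k > 0 \<Longrightarrow> t \<in> {c<..<d} \<Longrightarrow> bump k c d t > 0"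
  by (auto simp: bump_def flat_power_def)

lemma bump_tendsto_indicator:
  "(\<lambda>k. bump (real (Suc k)) c d t) \<longlonglongrightarrow> indicator {c<..<d} t"
proof (cases "t \<in> {c<..<d}")
  case True
  have "(\<lambda>k. flat_power 0 (real (Suc k) * x)) \<longlonglongrightarrow> 1" if "x > 0" for x
  proof -
    have "(\<lambda>k. exp (- (inverse (real (Suc k)) * inverse x))) \<longlonglongrightarrow> exp (- (0 * inverse x))"
      by (intro tendsto_intros LIMSEQ_inverse_real_of_nat)
    moreover have "flat_power 0 (real (Suc k) * x) = exp (- (inverse (real (Suc k)) * inverse x))" for k
      using that by (simp add: flat_power_def zero_less_mult_iff del: of_nat_Suc)
    ultimately show ?thesis
      by simp
  qed
  from tendsto_mult[OF this[of "t - c"] this[of "d - t"]] True show ?thesis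
    by (simp add: bump_def)
qed (simp add: bump_outside)


section \<open>Real-valued test functions\<close>

lemma test_functionI:
  assumes "smooth \<phi>" "0 < \<alpha>" "\<beta> < 1" and out: "\<And>t. t \<notin> {\<alpha>..\<beta>} \<Longrightarrow> \<phi> t = 0"
  shows "test_function \<phi>"
proof -
  have sub: "{t. \<phi> t \<noteq> 0} \<subseteq> {\<alpha>..\<beta>}"
    using out by blast
  then have "closure {t. \<phi> t \<noteq> 0} \<subseteq> {\<alpha>..\<beta>}"
    by (rule closure_minimal) simp
  then have "closure {t. \<phi> t \<noteq> 0} \<subseteq> {0<..<1}"
    using assms(2,3) by auto
  moreover have "compact (closure {t. \<phi> t \<noteq> 0})"
    using bounded_subset[OF bounded_closed_interval sub] by simp
  ultimately show ?thesis
    using assms(1) by (simp add: test_function_def smooth_def)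
qed

lemma test_function_smooth: "test_function \<phi> \<Longrightarrow> smooth \<phi>"
  by (simp add: test_function_def smooth_def)

lemma test_functionE:
  assumes "test_function \<phi>"
  obtains \<alpha> \<beta> where "0 < \<alpha>" "\<alpha> < \<beta>" "\<beta> < 1" "\<And>k t. t \<notin> {\<alpha>..\<beta>} \<Longrightarrow> iter_deriv k \<phi> t = 0"
proof -
  define K where "K = insert (1/2) (closure {t. \<phi> t \<noteq> 0})"
  have K: "compact K" "K \<noteq> {}" "K \<subseteq> {0<..<1}"
    using assms by (auto simp: test_function_def K_def)
  obtain p where p: "p \<in> K" "\<And>t. t \<in> K \<Longrightarrow> p \<le> t"
    using compact_attains_inf[OF K(1,2)] by blast
  obtain q where q: "q \<in> K" "\<And>t. t \<in> K \<Longrightarrow> t \<le> q"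
    using compact_attains_sup[OF K(1,2)] by blast
  show thesis
  proof
    show "0 < p / 2"
      using p K(3) by auto
    show "p / 2 < q"
      using p(1) q(2)[OF p(1)] K(3) by auto
    show "q < 1"
      using q K(3) by auto
    show "iter_deriv k \<phi> t = 0" if t: "t \<notin> {p/2..q}" for k t
    proof (rule iter_deriv_eq_0)
      show "open (- {p/2..q})"
        by (simp add: open_Compl)
      show "\<phi> s = 0" if "s \<in> - {p/2..q}" for s
      proof (rule ccontr)
        assume "\<phi> s \<noteq> 0"
        then have "s \<in> K"
          using closure_subset[of "{t. \<phi> t \<noteq> 0}"] by (auto simp: K_def)
        moreover have "0 < p"
          using p K(3) by auto
        ultimately show False
          using p(2)[of s] q(2)[of s] that by auto
      qed
    qed (use t in simp)
  qed
qed

lemma test_function_deriv: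
  "test_function \<phi> \<Longrightarrow> (iter_deriv k \<phi> has_vector_derivative iter_deriv (Suc k) \<phi> t) (at t)"
  by (intro smooth_deriv test_function_smooth)

lemma test_function_iter_deriv:
  assumes "test_function \<phi>"
  shows "test_function (iter_deriv k \<phi>)"
proof -
  obtain \<alpha> \<beta> where "0 < \<alpha>" "\<alpha> < \<beta>" "\<beta> < 1"
    "\<And>k t. t \<notin> {\<alpha>..\<beta>} \<Longrightarrow> iter_deriv k \<phi> t = 0"
    by (rule test_functionE[OF assms]) blast
  then show ?thesis
    by (intro test_functionI[of _ \<alpha> \<beta>] smooth_iter_deriv test_function_smooth[OF assms])
qed

lemma test_function_bump:
  assumes "k > 0" "0 < c" "d < 1"
  shows "test_function (bump k c d)"
  using assms by (intro test_functionI[of _ c d] smooth_bump) (auto intro!: bump_outside)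

lemma test_function_scaleR:
  fixes \<phi> :: "real \<Rightarrow> real"
  assumes "test_function \<phi>"
  shows "test_function (\<lambda>t. \<phi> t *\<^sub>R e)"
proof -
  obtain \<alpha> \<beta> where "0 < \<alpha>" "\<alpha> < \<beta>" "\<beta> < 1"
    "\<And>k t. t \<notin> {\<alpha>..\<beta>} \<Longrightarrow> iter_deriv k \<phi> t = 0"
    by (rule test_functionE[OF assms]) blast
  from this(1,3) this(4)[of _ 0] show ?thesis
    by (intro test_functionI[of _ \<alpha> \<beta>] smooth_scaleR_vector test_function_smooth[OF assms]) auto
qed

lemma test_function_linear_combination:
  assumes \<phi>: "test_function \<phi>" and \<psi>: "test_function \<psi>"
  shows "test_function (\<lambda>t. a *\<^sub>R \<phi> t + b *\<^sub>R \<psi> t)"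
proof -
  obtain \<alpha> \<beta> where 1: "0 < \<alpha>" "\<alpha> < \<beta>" "\<beta> < 1"
    "\<And>k t. t \<notin> {\<alpha>..\<beta>} \<Longrightarrow> iter_deriv k \<phi> t = 0"
    by (rule test_functionE[OF \<phi>]) blast
  obtain \<alpha>' \<beta>' where 2: "0 < \<alpha>'" "\<alpha>' < \<beta>'" "\<beta>' < 1"
    "\<And>k t. t \<notin> {\<alpha>'..\<beta>'} \<Longrightarrow> iter_deriv k \<psi> t = 0"
    by (rule test_functionE[OF \<psi>]) blast
  show ?thesis
  proof (rule test_functionI)
    show "0 < min \<alpha> \<alpha>'" "max \<beta> \<beta>' < 1"
      using 1 2 by auto
    show "a *\<^sub>R \<phi> t + b *\<^sub>R \<psi> t = 0" if "t \<notin> {min \<alpha> \<alpha>'..max \<beta> \<beta>'}" for t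
    proof -
      have "t \<notin> {\<alpha>..\<beta>}" "t \<notin> {\<alpha>'..\<beta>'}"
        using that by auto
      then show ?thesis
        using 1(4)[of t 0] 2(4)[of t 0] by simp
    qed
  qed (intro smooth_linear_combination test_function_smooth[OF \<phi>] test_function_smooth[OF \<psi>])
qed

lemma test_function_diff_scale:
  fixes \<phi> \<psi> :: "real \<Rightarrow> real"
  assumes "test_function \<phi>" "test_function \<psi>"
  shows "test_function (\<lambda>t. \<phi> t - c * \<psi> t)"
    and "iter_deriv k (\<lambda>t. \<phi> t - c * \<psi> t) = (\<lambda>t. iter_deriv k \<phi> t - c * iter_deriv k \<psi> t)"
  using test_function_linear_combination[OF assms, of 1 "- c"]
    smooth_linear_combination(2)[OF assms[THEN test_function_smooth], of k 1 "- c"] by simp_all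

text \<open>
  The mean is the obstruction: the primitive that vanishes at 0 must return to zero before 1 in order
  to have compact support.
\<close>

lemma test_function_antiderivative:
  fixes \<psi> :: "real \<Rightarrow> real"
  assumes \<psi>: "test_function \<psi>" and mean: "integral {0..1} \<psi> = 0"
  obtains \<phi> where "test_function \<phi>" "\<And>t. (\<phi> has_vector_derivative \<psi> t) (at t)"
proof -
  obtain \<alpha> \<beta> where ab: "0 < \<alpha>" "\<alpha> < \<beta>" "\<beta> < 1" "\<And>k t. t \<notin> {\<alpha>..\<beta>} \<Longrightarrow> iter_deriv k \<psi> t = 0"
    by (rule test_functionE[OF \<psi>]) blast
  have out: "\<psi> t = 0" if "t \<notin> {\<alpha>..\<beta>}" for t
    using ab(4)[OF that, of 0] by simp
  have cont: "continuous_on S \<psi>" for S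
    using iter_deriv_continuous[OF \<psi>, of S 0] by simp
  define \<phi> where "\<phi> = (\<lambda>t. integral {0..t} \<psi>)"
  have left: "\<phi> t = 0" if "t < \<alpha>" for t
  proof -
    have "integral {0..t} \<psi> = integral {0..t} (\<lambda>_. 0)"
      using that by (intro integral_cong out) auto
    then show ?thesis
      by (simp add: \<phi>_def)
  qed
  have right: "\<phi> t = 0" if "t > \<beta>" for t
  proof -
    have "integral {0..t} \<psi> = integral {\<alpha>..\<beta>} \<psi>"
      using that ab out by (intro integral_spike_set) (auto intro!: negligible_subset[OF negligible_empty])
    also have "\<dots> = integral {0..1} \<psi>"
      using ab out by (intro integral_spike_set) (auto intro!: negligible_subset[OF negligible_empty])
    finally show ?thesis
      using mean by (simp add: \<phi>_def)
  qed
  have deriv: "(\<phi> has_vector_derivative \<psi> t) (at t)" for t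
  proof (cases "t < \<alpha>")
    case True
    have "((\<lambda>_. 0) has_vector_derivative \<psi> t) (at t)"
      using out[of t] True by simp
    then show ?thesis
      by (rule has_vector_derivative_transform_within_open[of _ _ _ "{..<\<alpha>}"])
        (use True left in auto)
  next
    case False
    then have t: "t \<in> {0<..<t + 1}"
      using ab by auto
    have "(\<phi> has_vector_derivative \<psi> t) (at t within {0..t + 1})"
      unfolding \<phi>_def using t by (intro integral_has_vector_derivative cont) auto
    then show ?thesis
      using t at_within_interior[of t "{0..t + 1}"] by auto
  qed
  have "test_function \<phi>"
    using ab left right
    by (intro test_functionI[of _ \<alpha> \<beta>] smooth_antiderivative[OF test_function_smooth[OF \<psi>] deriv]) auto
  then show thesis
    using deriv that by blast
qed

section \<open>The fundamental lemma and the lemma of du Bois-Reymond\<close>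

text \<open>
  The sets over which \<^term>\<open>y\<close> integrates to zero form a Dynkin system. It contains the
  half-lines, hence all Borel sets, and up to null sets these are all measurable sets.
\<close>

lemma ae_zero_of_interval_integrals:
  fixes y :: "real \<Rightarrow> real"
  assumes y: "y absolutely_integrable_on {a..b}" and zero: "\<And>d. a \<le> d \<Longrightarrow> d \<le> b \<Longrightarrow> integral {a..d} y = 0"
  shows "AE t in lebesgue. t \<in> {a..b} \<longrightarrow> y t = 0"
proof -
  define y' where "y' = (\<lambda>t. indicator {a..b} t *\<^sub>R y t)"
  have y': "integrable lebesgue y'"
    using y by (simp add: y'_def set_integrable_def)
  have si: "set_integrable lebesgue A y'" if "A \<in> sets lebesgue" for A
    unfolding set_integrable_def using that y' by (rule integrable_mult_indicator)
  have upto: "(LINT t:{..d}|lebesgue. y' t) = 0" for d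
  proof -
    have *: "indicator {..d} t *\<^sub>R y' t = indicator {a..min d b} t *\<^sub>R y t" for t
      by (auto simp: y'_def indicator_def)
    have "(LINT t:{..d}|lebesgue. y' t) = (LINT t:{a..min d b}|lebesgue. y t)"
      unfolding set_lebesgue_integral_def * ..
    also have "\<dots> = integral {a..min d b} y"
      by (intro set_lebesgue_integral_eq_integral set_integrable_subset[OF y]) auto
    also have "\<dots> = 0"
      using zero[of "min d b"] by (cases "a \<le> min d b") auto
    finally show ?thesis .
  qed
  have total: "(LINT t:UNIV|lebesgue. y' t) = 0"
  proof -
    have *: "indicator UNIV t *\<^sub>R y' t = indicator {..b} t *\<^sub>R y' t" for t
      by (auto simp: y'_def indicator_def)
    show ?thesis
      using upto[of b] unfolding set_lebesgue_integral_def * .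
  qed
  have bor: "(LINT t:A|lebesgue. y' t) = 0" if A: "A \<in> sets borel" for A
  proof -
    have gen: "sets borel = sigma_sets UNIV (range (\<lambda>d::real. {..d}))"
      unfolding borel_eq_atMost by (rule sets_measure_of) auto
    have "Int_stable (range (\<lambda>d::real. {..d}))"
      by (rule Int_stableI) auto
    moreover have "range (\<lambda>d::real. {..d}) \<subseteq> Pow UNIV"
      by simp
    moreover have "A \<in> sigma_sets UNIV (range (\<lambda>d::real. {..d}))"
      using A gen by simp
    ultimately show ?thesis
    proof (induction rule: sigma_sets_induct_disjoint)
      case (basic A)
      then show ?case
        using upto by auto
    next
      case empty
      show ?case
        by (simp add: set_lebesgue_integral_def)
    next
      case (compl A)
      then have m: "A \<in> sets lebesgue" "UNIV - A \<in> sets lebesgue"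
        using gen sigma_sets.Compl[OF compl(1)] by (auto intro!: sets_completionI_sets)
      have "(LINT t:A \<union> (UNIV - A)|lebesgue. y' t) = (LINT t:A|lebesgue. y' t) + (LINT t:UNIV - A|lebesgue. y' t)"
        using m by (intro set_integral_Un si) auto
      then show ?case
        using compl total by simp
    next
      case (union A)
      have "A i \<in> sigma_sets UNIV (range (\<lambda>d::real. {..d}))" for i
        using union.hyps by blast
      then have m: "A i \<in> sets lebesgue" for i
        using gen by (auto intro!: sets_completionI_sets)
      then have "(LINT t:(\<Union>i. A i)|lebesgue. y' t) = (\<Sum>i. (LINT t:A i|lebesgue. y' t))"
        using union by (intro lebesgue_integral_countable_add si) (auto simp: disjoint_family_on_def)
      then show ?case
        using union by simp
    qed
  qed
  have "AE t in lebesgue. y' t = (\<lambda>_. 0) t"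
  proof (rule density_unique_real[OF y'])
    fix A :: "real set"
    assume A: "A \<in> sets lebesgue"
    then obtain C T where C: "fsigma C" "T \<in> null_sets lebesgue" "C \<union> T = A" "disjnt C T"
      by (rule lebesgue_set_almost_fsigma)
    have Cb: "C \<in> sets borel"
      using C(1) by cases (auto intro!: borel_closed)
    have "(A - C) \<union> (C - A) = T"
      using C(3,4) by (auto simp: disjnt_def)
    then have "(LINT t:A|lebesgue. y' t) = (LINT t:C|lebesgue. y' t)"
      using A Cb C(2) by (intro set_integral_null_delta[OF y']) (auto intro: sets_completionI_sets)
    also have "\<dots> = 0"
      by (rule bor[OF Cb])
    finally show "(LINT t:A|lebesgue. y' t) = (LINT t:A|lebesgue. 0)"
      by (simp add: set_lebesgue_integral_def)
  qed simp
  then show ?thesis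
    by eventually_elim (auto simp: y'_def)
qed

lemma absolutely_integrable_scaleR_continuous:
  fixes \<phi> :: "real \<Rightarrow> real" and f :: "real \<Rightarrow> 'a::euclidean_space"
  assumes f: "f absolutely_integrable_on {a..b}" and \<phi>: "continuous_on {a..b} \<phi>"
  shows "(\<lambda>t. \<phi> t *\<^sub>R f t) absolutely_integrable_on {a..b}"
proof (rule absolutely_integrable_bounded_measurable_product[where h = "\<lambda>(c::real) x::'a. c *\<^sub>R x", OF _ _ _ _ f])
  show "bilinear (\<lambda>(c::real) x::'a. c *\<^sub>R x)"
    by (simp add: bilinear_def linear_iff algebra_simps)
  show "\<phi> \<in> borel_measurable (lebesgue_on {a..b})"
    using \<phi> by (intro continuous_imp_measurable_on_sets_lebesgue) auto
  show "bounded (\<phi> ` {a..b})"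
    using \<phi> by (intro compact_imp_bounded compact_continuous_image) auto
qed simp

text \<open>
  Only the endpoint 0 is singular, so integrability is required up to 1.
\<close>

definition loc_integrable :: "(real \<Rightarrow> 'a::euclidean_space) \<Rightarrow> bool"
  where "loc_integrable f \<longleftrightarrow> (\<forall>s>0. f absolutely_integrable_on {s..1})"

lemma loc_integrable_subinterval:
  assumes "loc_integrable f" "0 < c" "d \<le> 1"
  shows "f absolutely_integrable_on {c..d}"
  using assms by (auto simp: loc_integrable_def intro: set_integrable_subset[of _ "{c..1}"])

lemma loc_integrable_add:
  "loc_integrable f \<Longrightarrow> loc_integrable g \<Longrightarrow> loc_integrable (\<lambda>t. f t + g t)"
  by (auto simp: loc_integrable_def intro: set_integral_add)

lemma loc_integrable_scaleR:
  fixes f :: "real \<Rightarrow> 'a::euclidean_space"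
  shows "loc_integrable f \<Longrightarrow> loc_integrable (\<lambda>t. c *\<^sub>R f t)"
  by (auto simp: loc_integrable_def)

lemma loc_integrable_continuous:
  fixes f :: "real \<Rightarrow> 'a::euclidean_space"
  shows "(\<And>s. s > 0 \<Longrightarrow> continuous_on {s..1} f) \<Longrightarrow> loc_integrable f"
  unfolding loc_integrable_def by (auto intro!: absolutely_integrable_continuous_real)

lemma test_scaleR_integrable:
  fixes \<phi> :: "real \<Rightarrow> real" and f :: "real \<Rightarrow> 'a::euclidean_space"
  assumes \<phi>: "test_function \<phi>" and f: "loc_integrable f"
  shows "(\<lambda>t. \<phi> t *\<^sub>R f t) absolutely_integrable_on {0..1}"
proof -
  obtain \<alpha> \<beta> where ab: "0 < \<alpha>" "\<alpha> < \<beta>" "\<beta> < 1"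
    "\<And>k t. t \<notin> {\<alpha>..\<beta>} \<Longrightarrow> iter_deriv k \<phi> t = 0"
    by (rule test_functionE[OF \<phi>]) blast
  have "(\<lambda>t. \<phi> t *\<^sub>R f t) absolutely_integrable_on {\<alpha>..\<beta>}"
    using ab iter_deriv_continuous[OF \<phi>, of _ 0]
    by (intro absolutely_integrable_scaleR_continuous loc_integrable_subinterval[OF f]) auto
  moreover have "indicator {\<alpha>..\<beta>} t *\<^sub>R (\<phi> t *\<^sub>R f t) = indicator {0..1} t *\<^sub>R (\<phi> t *\<^sub>R f t)" for t
    using ab(1,3) ab(4)[of t 0] by (auto simp: indicator_def)
  ultimately show ?thesis
    unfolding set_integrable_def by (simp only:)
qed

text \<open>
  The bumps of height at most one converge to the indicator of an interval, so dominated convergence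
  makes the integral of \<^term>\<open>z\<close> over every compact interval vanish.
\<close>

lemma fundamental_lemma:
  fixes z :: "real \<Rightarrow> 'a::euclidean_space"
  assumes z: "loc_integrable z"
    and zero: "\<And>\<phi>. test_function \<phi> \<Longrightarrow> integral {0..1} (\<lambda>t. \<phi> t *\<^sub>R z t) = 0"
  shows "AE t in I01. z t = 0"
proof -
  have int0: "integral {c..d} z = 0" if cd: "0 < c" "d < 1" for c d
  proof -
    have zi: "z absolutely_integrable_on {c..1}"
      using z cd by (simp add: loc_integrable_def)
    have lim: "(\<lambda>k. integral {c..1} (\<lambda>t. bump (real (Suc k)) c d t *\<^sub>R z t))
        \<longlonglongrightarrow> integral {c..1} (\<lambda>t. indicator {c<..<d} t *\<^sub>R z t)"
    proof (rule dominated_convergence(2)[where h = "\<lambda>t. norm (z t)"])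
      show "(\<lambda>t. bump (real (Suc k)) c d t *\<^sub>R z t) integrable_on {c..1}" for k
        using smooth_bump[of "real (Suc k)" c d] test_function_bump[of "real (Suc k)" c d] cd
        by (intro set_lebesgue_integral_eq_integral(1) absolutely_integrable_scaleR_continuous zi)
          (use iter_deriv_continuous[of "bump (real (Suc k)) c d" _ 0] in auto)
      show "(\<lambda>t. norm (z t)) integrable_on {c..1}"
        using zi by (simp add: absolutely_integrable_on_def)
      show "norm (bump (real (Suc k)) c d t *\<^sub>R z t) \<le> norm (z t)" for k t
        using bump_bounds[of "real (Suc k)" c d t] by (simp add: mult_left_le_one_le)
      show "(\<lambda>k. bump (real (Suc k)) c d t *\<^sub>R z t) \<longlonglongrightarrow> indicator {c<..<d} t *\<^sub>R z t" for t
        by (intro tendsto_intros bump_tendsto_indicator)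
    qed
    have "integral {c..1} (\<lambda>t. bump (real (Suc k)) c d t *\<^sub>R z t)
        = integral {0..1} (\<lambda>t. bump (real (Suc k)) c d t *\<^sub>R z t)" for k
      using cd by (intro integral_spike_set)
        (auto intro!: negligible_subset[OF negligible_empty] simp: bump_outside)
    also have "\<dots> k = 0" for k
      using cd by (intro zero test_function_bump) auto
    finally have "integral {c..1} (\<lambda>t. indicator {c<..<d} t *\<^sub>R z t) = 0"
      using lim LIMSEQ_unique[OF _ tendsto_const] by simp
    also have "integral {c..1} (\<lambda>t. indicator {c<..<d} t *\<^sub>R z t) = integral {c<..<d} z"
    proof -
      have "integral {c..1} (\<lambda>t. indicator {c<..<d} t *\<^sub>R z t)
          = integral {c..1} (\<lambda>t. if t \<in> {c<..<d} then z t else 0)"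
        by (intro integral_cong) (auto simp: indicator_def)
      also have "\<dots> = integral ({c<..<d} \<inter> {c..1}) z"
        by (rule integral_restrict_Int)
      also have "{c<..<d} \<inter> {c..1} = {c<..<d}"
        using cd by auto
      finally show ?thesis .
    qed
    finally show ?thesis
      by (simp add: integral_open_interval_real)
  qed
  have ae: "AE t in lebesgue. t \<in> {1 / real (n + 2)..1 - 1 / real (n + 2)} \<longrightarrow> z t \<bullet> e = 0"
    if e: "e \<in> Basis" for n e
  proof (rule ae_zero_of_interval_integrals)
    have zi: "z absolutely_integrable_on {1 / real (n + 2)..d}" if "d \<le> 1" for d
      using that by (intro loc_integrable_subinterval[OF z]) auto
    then show "(\<lambda>t. z t \<bullet> e) absolutely_integrable_on {1 / real (n + 2)..1 - 1 / real (n + 2)}"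
      using e by (intro absolutely_integrable_component) auto
    fix d
    assume "d \<le> 1 - 1 / real (n + 2)"
    moreover have "1 / real (n + 2) > 0"
      by simp
    ultimately have d: "d < 1"
      by linarith
    have "integral {1 / real (n + 2)..d} z \<bullet> e = integral {1 / real (n + 2)..d} (\<lambda>t. z t \<bullet> e)"
      using zi[of d] d by (intro integral_component_eq[symmetric]) (auto simp: absolutely_integrable_on_def)
    then show "integral {1 / real (n + 2)..d} (\<lambda>t. z t \<bullet> e) = 0"
      using int0[of "1 / real (n + 2)" d] d by simp
  qed
  have "AE t in lebesgue. \<forall>e\<in>Basis. \<forall>n::nat. t \<in> {1 / real (n + 2)..1 - 1 / real (n + 2)} \<longrightarrow> z t \<bullet> e = 0"
  proof (subst AE_ball_countable)
    show "\<forall>e\<in>Basis. AE t in lebesgue. \<forall>n::nat. t \<in> {1 / real (n + 2)..1 - 1 / real (n + 2)} \<longrightarrow> z t \<bullet> e = 0"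
      using ae unfolding AE_all_countable by blast
  qed (simp add: countable_finite)
  then have "AE t in lebesgue. t \<in> {0<..<1} \<longrightarrow> z t = 0"
  proof eventually_elim
    case (elim t)
    show ?case
    proof
      assume t: "t \<in> {0<..<1}"
      obtain n :: nat where n: "1 / real (Suc n) < min t (1 - t)"
        using t nat_approx_posE[of "min t (1 - t)"] by auto
      have "1 / real (n + 2) \<le> 1 / real (Suc n)"
        by (simp add: field_simps)
      then have "t \<in> {1 / real (n + 2)..1 - 1 / real (n + 2)}"
        using n by simp
      then show "z t = 0"
        using elim by (metis euclidean_all_zero_iff)
    qed
  qed
  then show ?thesis
    by (simp add: AE_restrict_space_iff)
qed

text \<open>
  Two primitives are taken off one at a time. A test function is a multiple of a fixed one of nonzero
  mean plus the derivative of a test function, so a distribution that kills derivatives is a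
  constant; used for the derivative of \<^term>\<open>z\<close> and then for \<^term>\<open>z\<close> itself, this gives
  an affine function.
\<close>

lemma du_Bois_Reymond:
  fixes z :: "real \<Rightarrow> 'a::euclidean_space"
  assumes z: "loc_integrable z"
    and zero: "\<And>\<phi>. test_function \<phi> \<Longrightarrow> integral {0..1} (\<lambda>t. iter_deriv 2 \<phi> t *\<^sub>R z t) = 0"
  shows "\<exists>a b. AE t in I01. z t = a + t *\<^sub>R b"
proof -
  let ?I = "\<lambda>\<phi> y. integral {0..1::real} (\<lambda>t. (\<phi> t :: real) *\<^sub>R (y t :: 'a))"
  have int: "(\<lambda>t. \<phi> t *\<^sub>R y t) integrable_on {0..1}" if "test_function \<phi>" "loc_integrable y"
    for \<phi> :: "real \<Rightarrow> real" and y :: "real \<Rightarrow> 'a"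
    by (rule set_lebesgue_integral_eq_integral(1)[OF test_scaleR_integrable[OF that]])
  have lin1: "?I (\<lambda>t. \<phi> t - c * \<psi> t) y = ?I \<phi> y - c *\<^sub>R ?I \<psi> y"
    if "test_function \<phi>" "test_function \<psi>" "loc_integrable y" for \<phi> \<psi> c and y :: "real \<Rightarrow> 'a"
    using int[OF that(1,3)] int[OF that(2,3)]
    by (simp add: scaleR_diff_left integral_diff integrable_cmul scaleR_scaleR[symmetric]
        del: scaleR_scaleR)
  have cont: "continuous_on S \<phi>" if "test_function \<phi>" for S and \<phi> :: "real \<Rightarrow> real"
    using iter_deriv_continuous[OF that, of S 0] by simp
  define \<eta> where "\<eta> = bump 1 (1/3) (2/3)"
  have \<eta>: "test_function \<eta>"
    unfolding \<eta>_def by (rule test_function_bump) auto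
  have "integral {0..1} \<eta> \<noteq> 0"
  proof
    assume "integral {0..1} \<eta> = 0"
    moreover have "\<And>t. t \<in> {0..1} \<Longrightarrow> 0 \<le> \<eta> t"
      by (simp add: \<eta>_def bump_bounds)
    ultimately have "\<eta> (1/2) = 0"
      using integral_eq_0_iff[OF cont[OF \<eta>], of 0 1] by auto
    then show False
      using bump_pos[of 1 "1/2" "1/3" "2/3"] by (simp add: \<eta>_def)
  qed
  then obtain c where c: "c * integral {0..1} \<eta> = 1"
    by (metis nonzero_divide_eq_eq)
  have decomp: "\<exists>\<phi>. test_function \<phi> \<and> (\<forall>k. iter_deriv (Suc k) \<phi>
      = (\<lambda>t. iter_deriv k \<psi> t - (integral {0..1} \<psi> * c) * iter_deriv k \<eta> t))"
    if \<psi>: "test_function \<psi>" for \<psi>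
  proof -
    let ?m = "integral {0..1} \<psi> * c"
    have "integral {0..1} (\<lambda>t. \<psi> t - ?m * \<eta> t) = integral {0..1} \<psi> - ?m * integral {0..1} \<eta>"
      by (subst integral_diff) (auto intro!: integrable_continuous_real continuous_on_mult_left cont[OF \<psi>] cont[OF \<eta>])
    also have "\<dots> = 0"
      using c by (simp add: mult.assoc)
    finally obtain \<phi> where \<phi>: "test_function \<phi>"
      "\<And>t. (\<phi> has_vector_derivative \<psi> t - ?m * \<eta> t) (at t)"
      using test_function_antiderivative[OF test_function_diff_scale(1)[OF \<psi> \<eta>]] by blast
    note test_function_diff_scale(2)[OF \<psi> \<eta>, of _ ?m]
    then have "iter_deriv (Suc k) \<phi> = (\<lambda>t. iter_deriv k \<psi> t - ?m * iter_deriv k \<eta> t)" for k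
      using iter_deriv_Suc_shift[OF \<phi>(2), of k] by simp
    then show ?thesis
      using \<phi>(1) by blast
  qed
  have z1: "?I (iter_deriv 1 \<psi>) z = (integral {0..1} \<psi> * c) *\<^sub>R ?I (iter_deriv 1 \<eta>) z"
    if \<psi>: "test_function \<psi>" for \<psi>
  proof -
    obtain \<phi> where \<phi>: "test_function \<phi>" "\<And>k. iter_deriv (Suc k) \<phi>
        = (\<lambda>t. iter_deriv k \<psi> t - (integral {0..1} \<psi> * c) * iter_deriv k \<eta> t)"
      using decomp[OF \<psi>] by blast
    show ?thesis
      using zero[OF \<phi>(1)] \<phi>(2)[of 1]
        lin1[OF test_function_iter_deriv[OF \<psi>, of 1] test_function_iter_deriv[OF \<eta>, of 1] z]
      by (simp add: numeral_2_eq_2)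
  qed
  define b where "b = c *\<^sub>R ?I (iter_deriv 1 \<eta>) z"
  define y where "y = (\<lambda>t. z t + t *\<^sub>R b)"
  have yl: "loc_integrable (\<lambda>t. t *\<^sub>R b)"
    by (intro loc_integrable_continuous continuous_intros)
  then have y: "loc_integrable y"
    unfolding y_def by (intro loc_integrable_add z)
  have y1: "?I (iter_deriv 1 \<psi>) y = 0" if \<psi>: "test_function \<psi>" for \<psi>
  proof -
    note \<psi>1 = test_function_iter_deriv[OF \<psi>, of 1]
    obtain \<alpha> \<beta> where "0 < \<alpha>" "\<alpha> < \<beta>" "\<beta> < 1"
      "\<And>k t. t \<notin> {\<alpha>..\<beta>} \<Longrightarrow> iter_deriv k \<psi> t = 0"
      by (rule test_functionE[OF \<psi>]) blast
    from this(3) this(4)[of 1 0] have \<psi>0: "\<psi> 1 = 0"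
      by simp
    have "((\<lambda>t. \<psi> t + t * iter_deriv 1 \<psi> t) has_integral 1 * \<psi> 1 - 0 * \<psi> 0) {0..1}"
    proof (rule fundamental_theorem_of_calculus)
      show "((\<lambda>t. t * \<psi> t) has_vector_derivative \<psi> t + t * iter_deriv 1 \<psi> t) (at t within {0..1})" for t
        using test_function_deriv[OF \<psi>, of 0 t] unfolding has_real_derivative_iff_has_vector_derivative[symmetric]
        by (auto intro!: derivative_eq_intros intro: has_field_derivative_at_within)
    qed simp
    moreover have "(\<psi> has_integral integral {0..1} \<psi>) {0..1}"
      by (intro integrable_integral integrable_continuous_real cont \<psi>)
    ultimately have "((\<lambda>t. (\<psi> t + t * iter_deriv 1 \<psi> t) - \<psi> t) has_integral
        (1 * \<psi> 1 - 0 * \<psi> 0) - integral {0..1} \<psi>) {0..1}"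
      by (rule has_integral_diff)
    then have "((\<lambda>t. t * iter_deriv 1 \<psi> t) has_integral - integral {0..1} \<psi>) {0..1}"
      using \<psi>0 by simp
    from has_integral_scaleR_left[OF this, of b]
    have "((\<lambda>t. iter_deriv 1 \<psi> t *\<^sub>R t *\<^sub>R b) has_integral (- integral {0..1} \<psi>) *\<^sub>R b) {0..1}"
      by (simp add: mult.commute)
    then have "?I (iter_deriv 1 \<psi>) (\<lambda>t. t *\<^sub>R b) = (- integral {0..1} \<psi>) *\<^sub>R b"
      by (rule integral_unique)
    moreover have "?I (iter_deriv 1 \<psi>) y = ?I (iter_deriv 1 \<psi>) z + ?I (iter_deriv 1 \<psi>) (\<lambda>t. t *\<^sub>R b)"
      unfolding y_def scaleR_add_right by (rule integral_add[OF int[OF \<psi>1 z] int[OF \<psi>1 yl]])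
    ultimately show ?thesis
      using z1[OF \<psi>] by (simp add: b_def)
  qed
  define a where "a = c *\<^sub>R ?I \<eta> y"
  have "AE t in I01. y t - a = 0"
  proof (rule fundamental_lemma)
    have al: "loc_integrable (\<lambda>_. a)"
      by (intro loc_integrable_continuous continuous_intros)
    have "loc_integrable (\<lambda>t. y t + (-1) *\<^sub>R a)"
      by (intro loc_integrable_add loc_integrable_scaleR y al)
    then show "loc_integrable (\<lambda>t. y t - a)"
      by simp
    fix \<psi> :: "real \<Rightarrow> real"
    assume \<psi>: "test_function \<psi>"
    obtain \<phi> where \<phi>: "test_function \<phi>" "\<And>k. iter_deriv (Suc k) \<phi>
        = (\<lambda>t. iter_deriv k \<psi> t - (integral {0..1} \<psi> * c) * iter_deriv k \<eta> t)"
      using decomp[OF \<psi>] by blast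
    have "?I \<psi> y = integral {0..1} \<psi> *\<^sub>R a"
      using y1[OF \<phi>(1)] \<phi>(2)[of 0] lin1[OF \<psi> \<eta> y] by (simp add: a_def)
    moreover have "?I \<psi> (\<lambda>t. y t - a) = ?I \<psi> y - ?I \<psi> (\<lambda>_. a)"
      unfolding scaleR_diff_right by (rule integral_diff[OF int[OF \<psi> y] int[OF \<psi> al]])
    moreover have "?I \<psi> (\<lambda>_. a) = integral {0..1} \<psi> *\<^sub>R a"
      by (intro integral_unique has_integral_scaleR_left integrable_integral
          integrable_continuous_real cont \<psi>)
    ultimately show "?I \<psi> (\<lambda>t. y t - a) = 0"
      by simp
  qed
  then have "AE t in I01. z t = a + t *\<^sub>R (- b)"
    by eventually_elim (simp add: y_def algebra_simps)
  then show ?thesis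
    by blast
qed


section \<open>Weak solutions of the second-order equation\<close>

text \<open>
  Integration by parts, for a primitive whose density is merely integrable, is an exchange of the
  order of integration. The primitive is based at the regular endpoint 1, since densities of
  interest need not be integrable at 0.
\<close>

lemma test_integration_by_parts:
  fixes f :: "real \<Rightarrow> 'a::euclidean_space" and \<phi> :: "real \<Rightarrow> real"
  assumes f: "loc_integrable f" and \<phi>: "test_function \<phi>"
  shows "integral {0..1} (\<lambda>t. iter_deriv 1 \<phi> t *\<^sub>R integral {t..1} f)
    = integral {0..1} (\<lambda>t. \<phi> t *\<^sub>R f t)"
proof -
  obtain \<alpha> \<beta> where ab: "0 < \<alpha>" "\<alpha> < \<beta>" "\<beta> < 1" "\<And>k t. t \<notin> {\<alpha>..\<beta>} \<Longrightarrow> iter_deriv k \<phi> t = 0"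
    by (rule test_functionE[OF \<phi>]) blast
  \<comment> \<open>A point to the left of the support, so that both \<open>\<phi>\<close> and its derivative vanish at it.\<close>
  define s where "s = \<alpha> / 2"
  have s: "0 < s" "s < \<alpha>" "s \<le> 1"
    using ab by (auto simp: s_def)
  define \<psi> where "\<psi> = iter_deriv 1 \<phi>"
  have \<psi>: "continuous_on S \<psi>" for S
    unfolding \<psi>_def by (rule iter_deriv_continuous[OF \<phi>])
  have out: "\<phi> t = 0" "\<psi> t = 0" if "t \<le> s" for t
    using ab(4)[of t 0] ab(4)[of t 1] that s by (auto simp: \<psi>_def)
  define M where "M = lebesgue_on {s..1}"
  interpret M: finite_measure M
    unfolding M_def using s by (intro finite_measureI) (simp add: emeasure_restrict_space)
  interpret MM: pair_sigma_finite M M ..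
  have space: "space M = {s..1}"
    by (simp add: M_def)
  have f_int: "f absolutely_integrable_on {c..1}" if "s \<le> c" for c
    using s that by (intro loc_integrable_subinterval[OF f]) auto
  have fM: "integrable M f"
    using f_int[of s] by (simp add: M_def integrable_restrict_space set_integrable_def)
  have \<psi>M: "integrable M \<psi>"
    using absolutely_integrable_continuous_real[OF \<psi>[of "{s..1}"]]
    by (simp add: M_def integrable_restrict_space set_integrable_def)
  have M_HK: "integral\<^sup>L M g = integral {s..1} g" if "integrable M g" for g :: "real \<Rightarrow> 'a"
    using that unfolding M_def by (intro lebesgue_integral_eq_integral) auto
  have [measurable]: "f \<in> borel_measurable M" "\<psi> \<in> borel_measurable M"
    using fM \<psi>M by auto
  have [measurable]: "(\<lambda>x. x) \<in> borel_measurable M"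
    unfolding M_def by (intro continuous_imp_measurable_on_sets_lebesgue continuous_on_id) auto
  \<comment> \<open>The integrand over the triangle \<open>t \<le> r\<close>, extended by zero to the square.\<close>
  define H where "H = (\<lambda>t r. (if t \<le> r then \<psi> t else 0) *\<^sub>R f r)"
  have Ht: "integrable M (\<lambda>r. H t r)" for t
    unfolding H_def
    by (rule Bochner_Integration.integrable_bound[of _ "\<lambda>r. \<psi> t *\<^sub>R f r"])
      (auto intro: integrable_scaleR_right fM)
  have Hr: "integrable M (\<lambda>t. H t r)" for r
    unfolding H_def
    by (rule Bochner_Integration.integrable_bound[of _ "\<lambda>t. \<psi> t *\<^sub>R f r"])
      (auto intro: integrable_scaleR_left \<psi>M)
  have "integrable (M \<Otimes>\<^sub>M M) (\<lambda>(t, r). H t r)"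
  proof (rule MM.Fubini_integrable)
    show "(\<lambda>(t, r). H t r) \<in> borel_measurable (M \<Otimes>\<^sub>M M)"
      unfolding H_def by measurable
    have "integrable M (\<lambda>t. norm (\<psi> t) * (LINT r|M. norm (f r)))"
      using \<psi>M by auto
    then show "integrable M (\<lambda>t. LINT r|M. norm (case (t, r) of (t, r) \<Rightarrow> H t r))"
    proof (rule Bochner_Integration.integrable_bound)
      show "(\<lambda>t. LINT r|M. norm (case (t, r) of (t, r) \<Rightarrow> H t r)) \<in> borel_measurable M"
        unfolding H_def by measurable
      have "(LINT r|M. norm (H t r)) \<le> (LINT r|M. norm (\<psi> t) * norm (f r))" for t
        by (intro integral_mono integrable_norm[OF Ht] integrable_mult_right integrable_norm[OF fM])
          (auto simp: H_def)
      then show "AE t in M. norm (LINT r|M. norm (case (t, r) of (t, r) \<Rightarrow> H t r))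
          \<le> norm (norm (\<psi> t) * (LINT r|M. norm (f r)))"
        by (intro AE_I2) (simp add: abs_of_nonneg)
    qed
    show "AE t in M. integrable M (\<lambda>r. case (t, r) of (t, r) \<Rightarrow> H t r)"
      using Ht by simp
  qed
  then have fub: "(LINT r|M. LINT t|M. H t r) = (LINT t|M. LINT r|M. H t r)"
    and fst: "integrable M (\<lambda>t. LINT r|M. H t r)" and snd: "integrable M (\<lambda>r. LINT t|M. H t r)"
    by (rule MM.Fubini_integral, rule MM.integrable_fst, rule MM.integrable_snd)
  have in_r: "(LINT r|M. H t r) = \<psi> t *\<^sub>R integral {t..1} f" if t: "t \<in> {s..1}" for t
  proof -
    have "(LINT r|M. H t r) = integral {s..1} (\<lambda>r. if r \<in> {t..1} then \<psi> t *\<^sub>R f r else 0)"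
      unfolding M_HK[OF Ht] by (intro integral_cong) (auto simp: H_def)
    also have "\<dots> = integral ({t..1} \<inter> {s..1}) (\<lambda>r. \<psi> t *\<^sub>R f r)"
      by (rule integral_restrict_Int)
    also have "{t..1} \<inter> {s..1} = {t..1}"
      using t by auto
    finally show ?thesis
      by simp
  qed
  have in_t: "(LINT t|M. H t r) = \<phi> r *\<^sub>R f r" if r: "r \<in> {s..1}" for r
  proof -
    have "(LINT t|M. H t r) = integral {s..1} (\<lambda>t. if t \<in> {s..r} then \<psi> t *\<^sub>R f r else 0)"
      unfolding M_HK[OF Hr] by (intro integral_cong) (auto simp: H_def)
    also have "\<dots> = integral ({s..r} \<inter> {s..1}) (\<lambda>t. \<psi> t *\<^sub>R f r)"
      by (rule integral_restrict_Int)
    also have "{s..r} \<inter> {s..1} = {s..r}"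
      using r by auto
    also have "integral {s..r} (\<lambda>t. \<psi> t *\<^sub>R f r) = (\<phi> r - \<phi> s) *\<^sub>R f r"
    proof (intro integral_unique has_integral_scaleR_left fundamental_theorem_of_calculus)
      show "(\<phi> has_vector_derivative \<psi> t) (at t within {s..r})" for t
        using test_function_deriv[OF \<phi>, of 0 t] by (simp add: \<psi>_def has_vector_derivative_at_within)
    qed (use r in auto)
    finally show ?thesis
      using out(1)[of s] by simp
  qed
  have "integral {s..1} (\<lambda>t. \<psi> t *\<^sub>R integral {t..1} f) = (LINT t|M. LINT r|M. H t r)"
    unfolding M_HK[OF fst] by (intro integral_cong) (simp add: in_r)
  also have "\<dots> = integral {s..1} (\<lambda>r. \<phi> r *\<^sub>R f r)"
    unfolding fub[symmetric] M_HK[OF snd] by (intro integral_cong) (simp add: in_t)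
  also have "\<dots> = integral {0..1} (\<lambda>r. \<phi> r *\<^sub>R f r)"
    using s out by (intro integral_spike_set) (auto intro!: negligible_subset[OF negligible_empty])
  finally have *: "integral {s..1} (\<lambda>t. \<psi> t *\<^sub>R integral {t..1} f) = integral {0..1} (\<lambda>r. \<phi> r *\<^sub>R f r)" .
  have "integral {0..1} (\<lambda>t. \<psi> t *\<^sub>R integral {t..1} f) = integral {s..1} (\<lambda>t. \<psi> t *\<^sub>R integral {t..1} f)"
    using s out by (intro integral_spike_set) (auto intro!: negligible_subset[OF negligible_empty])
  then show ?thesis
    using * by (simp add: \<psi>_def)
qed

text \<open>
  The solution $F$ of $F'' = f$ with $F(1) = F'(1) = 0$.
\<close>

definition second_primitive :: "(real \<Rightarrow> 'a::euclidean_space) \<Rightarrow> real \<Rightarrow> 'a"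
  where "second_primitive f t = integral {t..1} (\<lambda>s. integral {s..1} f)"

lemma continuous_tail_integral:
  assumes "loc_integrable f" "0 < s"
  shows "continuous_on {s..1} (\<lambda>t. integral {t..1} f)"
  using assms unfolding loc_integrable_def
  by (intro indefinite_integral_continuous_1') (auto simp: absolutely_integrable_on_def)

lemma loc_integrable_tail_integral:
  "loc_integrable f \<Longrightarrow> loc_integrable (\<lambda>t. integral {t..1} f)"
  by (rule loc_integrable_continuous) (rule continuous_tail_integral)

lemma continuous_second_primitive:
  "loc_integrable f \<Longrightarrow> 0 < s \<Longrightarrow> continuous_on {s..1} (second_primitive f)"
  unfolding second_primitive_def
  by (intro continuous_tail_integral loc_integrable_tail_integral)

lemma tail_integral_add:
  assumes "loc_integrable f" "loc_integrable g" "0 < t"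
  shows "integral {t..1} (\<lambda>s. f s + g s) = integral {t..1} f + integral {t..1} g"
  using assms by (intro integral_add) (auto simp: loc_integrable_def absolutely_integrable_on_def)

lemma second_primitive_add:
  assumes f: "loc_integrable f" and g: "loc_integrable g" and t: "0 < t"
  shows "second_primitive (\<lambda>s. f s + g s) t = second_primitive f t + second_primitive g t"
proof -
  have "second_primitive (\<lambda>s. f s + g s) t
      = integral {t..1} (\<lambda>s. integral {s..1} f + integral {s..1} g)"
    unfolding second_primitive_def using t by (intro integral_cong tail_integral_add f g) auto
  also have "\<dots> = second_primitive f t + second_primitive g t"
    unfolding second_primitive_def
    by (intro tail_integral_add loc_integrable_tail_integral f g t)
  finally show ?thesis .
qed

lemma second_primitive_scaleR:
  "second_primitive (\<lambda>s. c *\<^sub>R f s) t = c *\<^sub>R second_primitive f t"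
  by (simp add: second_primitive_def)

text \<open>
  Integrating by parts twice, the second primitive of \<^term>\<open>w\<close> satisfies the same weak equation as
  \<^term>\<open>u\<close>, so that the difference has vanishing second derivative in the weak sense.
\<close>

lemma weak_solution_representation:
  fixes u w :: "real \<Rightarrow> 'a::euclidean_space"
  assumes u: "loc_integrable u" and w: "loc_integrable w"
    and weak: "\<And>\<phi>. test_function \<phi> \<Longrightarrow>
      integral {0..1} (\<lambda>t. iter_deriv 2 \<phi> t *\<^sub>R u t) = integral {0..1} (\<lambda>t. \<phi> t *\<^sub>R w t)"
  shows "\<exists>a b. AE t in I01. u t = a + t *\<^sub>R b + second_primitive w t"
proof -
  note V = loc_integrable_tail_integral[OF w]
  have W: "loc_integrable (second_primitive w)"
    by (intro loc_integrable_continuous continuous_second_primitive w)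
  have "\<exists>a b. AE t in I01. u t + (-1) *\<^sub>R second_primitive w t = a + t *\<^sub>R b"
  proof (rule du_Bois_Reymond)
    show "loc_integrable (\<lambda>t. u t + (-1) *\<^sub>R second_primitive w t)"
      by (intro loc_integrable_add loc_integrable_scaleR u W)
    fix \<phi> :: "real \<Rightarrow> real"
    assume \<phi>: "test_function \<phi>"
    note \<phi>1 = test_function_iter_deriv[OF \<phi>, of 1] and \<phi>2 = test_function_iter_deriv[OF \<phi>, of 2]
    have d2: "iter_deriv 1 (iter_deriv 1 \<phi>) = iter_deriv 2 \<phi>"
      by (simp add: iter_deriv_def numeral_2_eq_2)
    have "integral {0..1} (\<lambda>t. iter_deriv 2 \<phi> t *\<^sub>R second_primitive w t)
        = integral {0..1} (\<lambda>t. iter_deriv 1 \<phi> t *\<^sub>R integral {t..1} w)"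
      using test_integration_by_parts[OF V \<phi>1] unfolding d2 second_primitive_def .
    also have "\<dots> = integral {0..1} (\<lambda>t. \<phi> t *\<^sub>R w t)"
      by (rule test_integration_by_parts[OF w \<phi>])
    also have "\<dots> = integral {0..1} (\<lambda>t. iter_deriv 2 \<phi> t *\<^sub>R u t)"
      by (rule weak[OF \<phi>, symmetric])
    finally have eq: "integral {0..1} (\<lambda>t. iter_deriv 2 \<phi> t *\<^sub>R second_primitive w t)
      = integral {0..1} (\<lambda>t. iter_deriv 2 \<phi> t *\<^sub>R u t)" .
    have "integral {0..1} (\<lambda>t. iter_deriv 2 \<phi> t *\<^sub>R (u t + (-1) *\<^sub>R second_primitive w t))
        = integral {0..1} (\<lambda>t. iter_deriv 2 \<phi> t *\<^sub>R u t - iter_deriv 2 \<phi> t *\<^sub>R second_primitive w t)"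
      by (simp add: scaleR_diff_right)
    also have "\<dots> = integral {0..1} (\<lambda>t. iter_deriv 2 \<phi> t *\<^sub>R u t)
        - integral {0..1} (\<lambda>t. iter_deriv 2 \<phi> t *\<^sub>R second_primitive w t)"
      by (intro integral_diff set_lebesgue_integral_eq_integral(1) test_scaleR_integrable \<phi>2 u W)
    finally show "integral {0..1} (\<lambda>t. iter_deriv 2 \<phi> t *\<^sub>R (u t + (-1) *\<^sub>R second_primitive w t)) = 0"
      using eq by simp
  qed
  then obtain a b where "AE t in I01. u t + (-1) *\<^sub>R second_primitive w t = a + t *\<^sub>R b"
    by blast
  then have "AE t in I01. u t = a + t *\<^sub>R b + second_primitive w t"
    by eventually_elim (simp add: algebra_simps)
  then show ?thesis
    by blast
qed

text \<open>
  Gronwall's argument by Picard iteration: the bound $B$ on $[s, 1]$ improves in $n$ steps to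
  $B (K (1 - t))^n / n!$. One of the two integrations is wasted by estimating the length of the
  interval by 1.
\<close>

lemma second_primitive_gronwall:
  fixes w :: "real \<Rightarrow> 'a::euclidean_space"
  assumes w: "loc_integrable w" and s: "0 < s" and K: "0 \<le> K"
    and bound: "\<And>t. t \<in> {s..1} \<Longrightarrow> norm (w t) \<le> K * norm (second_primitive w t)"
    and t: "t \<in> {s..1}"
  shows "second_primitive w t = 0"
proof -
  define U where "U = second_primitive w"
  have "compact (U ` {s..1})"
    unfolding U_def by (intro compact_continuous_image continuous_second_primitive w s) simp
  then obtain B where B: "\<And>t. t \<in> {s..1} \<Longrightarrow> norm (U t) \<le> B"
    using compact_imp_bounded by (fastforce simp: bounded_iff)
  have B0: "0 \<le> B"
    using B[OF t] norm_ge_zero order_trans by blast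
  have iter: "\<forall>t\<in>{s..1}. norm (U t) \<le> B * (K * (1 - t)) ^ n / fact n" for n
  proof (induction n)
    case 0
    show ?case
      using B by simp
  next
    case (Suc n)
    define g where "g = (\<lambda>x. K * (B * (K * (1 - x)) ^ n / fact n))"
    define G where "G = (\<lambda>x. B * (K * (1 - x)) ^ Suc n / fact (Suc n))"
    have gG: "(g has_integral G r) {r..1}" if "r \<le> 1" for r
    proof -
      have "(g has_integral (- G 1) - (- G r)) {r..1}"
      proof (rule fundamental_theorem_of_calculus[OF that])
        fix x
        have "((\<lambda>x. (K * (1 - x)) ^ Suc n) has_real_derivative (1 + real n) * (- K * (K * (1 - x)) ^ n))
            (at x within {r..1})"
          by (rule DERIV_power_Suc) (auto intro!: derivative_eq_intros)
        then have "((\<lambda>x. - (B / fact (Suc n)) * (K * (1 - x)) ^ Suc n) has_real_derivative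
            - (B / fact (Suc n)) * ((1 + real n) * (- K * (K * (1 - x)) ^ n))) (at x within {r..1})"
          by (rule DERIV_cmult)
        moreover have "- (B / fact (Suc n)) * ((1 + real n) * (- K * (K * (1 - x)) ^ n)) = g x"
          unfolding g_def fact_Suc by (simp add: divide_simps)
        moreover have "- (B / fact (Suc n)) * (K * (1 - x)) ^ Suc n = - G x" for x
          by (simp add: G_def)
        ultimately have "((\<lambda>x. - G x) has_real_derivative g x) (at x within {r..1})"
          by simp
        then show "((\<lambda>x. - G x) has_vector_derivative g x) (at x within {r..1})"
          by (simp add: has_real_derivative_iff_has_vector_derivative)
      qed
      then show ?thesis
        by (simp add: G_def)
    qed
    have V: "norm (integral {r..1} w) \<le> G r" if r: "r \<in> {s..1}" for r
    proof -
      have "norm (integral {r..1} w) \<le> integral {r..1} g"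
      proof (rule integral_norm_bound_integral)
        show "w integrable_on {r..1}"
          using w s r by (auto simp: loc_integrable_def absolutely_integrable_on_def)
        show "g integrable_on {r..1}"
          using gG r by auto
        fix x
        assume x: "x \<in> {r..1}"
        then have "norm (w x) \<le> K * norm (U x)"
          using bound[of x] r by (simp add: U_def)
        also have "\<dots> \<le> g x"
          unfolding g_def using Suc.IH x r K by (intro mult_left_mono) auto
        finally show "norm (w x) \<le> g x" .
      qed
      then show ?thesis
        using integral_unique[OF gG] r by simp
    qed
    have mono: "G r \<le> G t" if "t \<le> r" "r \<le> 1" for r t
      unfolding G_def using that K B0
      by (intro divide_right_mono mult_left_mono power_mono) auto
    have pos: "0 \<le> G t" if "t \<le> 1" for t
      unfolding G_def using that K B0 by simp
    show ?case
    proof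
      fix t
      assume t: "t \<in> {s..1}"
      have "norm (U t) \<le> integral {t..1} (\<lambda>_. G t)"
        unfolding U_def second_primitive_def
      proof (rule integral_norm_bound_integral)
        show "(\<lambda>r. integral {r..1} w) integrable_on {t..1}"
          using s t by (intro integrable_continuous_real continuous_tail_integral w) auto
        show "norm (integral {r..1} w) \<le> G t" if "r \<in> {t..1}" for r
          using V[of r] mono[of t r] that t by auto
      qed auto
      also have "\<dots> = (1 - t) * G t"
        using t by simp
      also have "\<dots> \<le> 1 * G t"
        using t s pos[of t] by (intro mult_right_mono) auto
      finally show "norm (U t) \<le> B * (K * (1 - t)) ^ Suc n / fact (Suc n)"
        by (simp add: G_def)
    qed
  qed
  have "(\<lambda>n. (K * (1 - t)) ^ n / fact n) \<longlonglongrightarrow> 0"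
    using summable_LIMSEQ_zero[OF summable_exp[of "K * (1 - t)"]] by (simp add: field_simps)
  then have "(\<lambda>n. B * ((K * (1 - t)) ^ n / fact n)) \<longlonglongrightarrow> B * 0"
    by (intro tendsto_intros)
  then have "norm (U t) \<le> 0"
    using iter t by (intro LIMSEQ_le_const[where X = "\<lambda>n. B * ((K * (1 - t)) ^ n / fact n)"]) auto
  then show ?thesis
    by (simp add: U_def)
qed


section \<open>The orthogonal complement of the range of the minimal operator\<close>

definition potential_term :: "(real \<Rightarrow> real^'n^'n) \<Rightarrow> (real \<Rightarrow> real^'n) \<Rightarrow> real \<Rightarrow> real^'n"
  where "potential_term R f t = (1 / t\<^sup>2) *\<^sub>R (R t *v f t)"

lemma potential_term_add:
  "potential_term R (\<lambda>t. f t + g t) = (\<lambda>t. potential_term R f t + potential_term R g t)"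
  by (simp add: potential_term_def fun_eq_iff matrix_vector_right_distrib scaleR_add_right)

lemma potential_term_scaleR:
  "potential_term R (\<lambda>t. c *\<^sub>R f t) = (\<lambda>t. c *\<^sub>R potential_term R f t)"
  by (simp add: potential_term_def fun_eq_iff matrix_vector_mult_scaleR)

lemma loc_integrable_square_integrable:
  fixes f :: "real \<Rightarrow> 'a::euclidean_space"
  assumes "square_integrable f"
  shows "loc_integrable f"
proof -
  have "f absolutely_integrable_on {0<..<1}"
    using square_integrable_integrable[OF assms]
    by (simp add: integrable_restrict_space set_integrable_def)
  then have "f absolutely_integrable_on {0..1}"
    by (simp add: absolutely_integrable_on_Icc_iff_Ioo)
  then show ?thesis
    unfolding loc_integrable_def by (auto intro: set_integrable_subset)
qed

lemma bilinear_matrix_vector_mult: "bilinear (\<lambda>A v. (A :: real^'n^'m) *v v)"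
  by (auto simp: bilinear_def linear_iff matrix_vector_right_distrib matrix_vector_mult_add_rdistrib
      matrix_vector_mult_scaleR scaleR_matrix_vector_assoc)

lemma loc_integrable_potential_term:
  fixes R :: "real \<Rightarrow> real^'n^'n"
  assumes R: "continuous_on {0..1} R" and f: "loc_integrable f"
  shows "loc_integrable (potential_term R f)"
  unfolding loc_integrable_def
proof (intro allI impI)
  fix s :: real
  assume s: "0 < s"
  have cont: "continuous_on {s..1} (\<lambda>t. (1 / t\<^sup>2) *\<^sub>R R t)"
    using s by (intro continuous_intros continuous_on_subset[OF R]) auto
  have "(\<lambda>t. ((1 / t\<^sup>2) *\<^sub>R R t) *v f t) absolutely_integrable_on {s..1}"
  proof (rule absolutely_integrable_bounded_measurable_product[OF bilinear_matrix_vector_mult])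
    show "(\<lambda>t. (1 / t\<^sup>2) *\<^sub>R R t) \<in> borel_measurable (lebesgue_on {s..1})"
      using cont by (intro continuous_imp_measurable_on_sets_lebesgue) auto
    show "bounded ((\<lambda>t. (1 / t\<^sup>2) *\<^sub>R R t) ` {s..1})"
      using cont by (intro compact_imp_bounded compact_continuous_image) auto
    show "f absolutely_integrable_on {s..1}"
      using f s by (simp add: loc_integrable_def)
  qed simp
  then show "potential_term R f absolutely_integrable_on {s..1}"
    unfolding potential_term_def[abs_def] by (simp add: scaleR_matrix_vector_assoc)
qed

lemma symmetric_matrix_inner:
  fixes A :: "real^'n^'n"
  assumes "transpose A = A"
  shows "v \<bullet> (A *v w) = (A *v v) \<bullet> w"
  using assms dot_lmul_matrix[of v A w] transpose_matrix_vector[of A v] by simp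

text \<open>
  Testing with \<open>\<phi> t *\<^sub>R e\<close> for a scalar test function \<^term>\<open>\<phi>\<close> gives the component of the weak
  equation along \<^term>\<open>e\<close>. Symmetry of the potential moves it from the test function to the solution.
\<close>

lemma orthogonal_bessel_range_weak_solution:
  fixes R :: "real \<Rightarrow> real^'n^'n"
  assumes R: "continuous_on {0..1} R" and sym: "\<And>t. t \<in> {0..1} \<Longrightarrow> transpose (R t) = R t"
    and f: "square_integrable f"
    and orth: "\<And>\<Phi>. test_function \<Phi> \<Longrightarrow> to_L2 f \<bullet> to_L2 (bessel_expr R \<Phi>) = 0"
    and \<phi>: "test_function \<phi>"
  shows "integral {0..1} (\<lambda>t. iter_deriv 2 \<phi> t *\<^sub>R f t) = integral {0..1} (\<lambda>t. \<phi> t *\<^sub>R potential_term R f t)"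
proof -
  let ?u = "\<lambda>t. iter_deriv 2 \<phi> t *\<^sub>R f t" and ?v = "\<lambda>t. \<phi> t *\<^sub>R potential_term R f t"
  note fl = loc_integrable_square_integrable[OF f]
  have ui: "?u integrable_on {0..1}"
    by (intro set_lebesgue_integral_eq_integral(1) test_scaleR_integrable test_function_iter_deriv \<phi> fl)
  have vi: "?v integrable_on {0..1}"
    by (intro set_lebesgue_integral_eq_integral(1) test_scaleR_integrable loc_integrable_potential_term \<phi> fl R)
  have "integral {0..1} ?u \<bullet> e = integral {0..1} ?v \<bullet> e" for e
  proof -
    let ?\<Phi> = "\<lambda>t. \<phi> t *\<^sub>R e"
    have \<Phi>: "test_function ?\<Phi>"
      by (rule test_function_scaleR[OF \<phi>])
    note b = square_integrable_bessel_expr[OF \<Phi> R]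
    have pt: "f t \<bullet> bessel_expr R ?\<Phi> t = ?v t \<bullet> e - ?u t \<bullet> e" if "t \<in> {0<..<1}" for t
    proof -
      have "f t \<bullet> (R t *v e) = (R t *v f t) \<bullet> e"
        using symmetric_matrix_inner[OF sym[of t]] that by simp
      then show ?thesis
        by (simp add: bessel_expr_def potential_term_def smooth_scaleR_vector(2)[OF test_function_smooth[OF \<phi>]]
            inner_diff_right inner_add_right matrix_vector_mult_scaleR inner_commute[of "f t" e])
    qed
    have "0 = (LINT t|I01. f t \<bullet> bessel_expr R ?\<Phi> t)"
      using orth[OF \<Phi>] inner_to_L2[OF f b] by simp
    also have "\<dots> = integral {0<..<1} (\<lambda>t. f t \<bullet> bessel_expr R ?\<Phi> t)"
      by (intro lebesgue_integral_eq_integral square_integrable_inner f b) auto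
    also have "\<dots> = integral {0<..<1} (\<lambda>t. ?v t \<bullet> e - ?u t \<bullet> e)"
      by (intro integral_cong pt)
    also have "\<dots> = integral {0..1} (\<lambda>t. ?v t \<bullet> e - ?u t \<bullet> e)"
      by (simp add: integral_open_interval_real)
    also have "\<dots> = integral {0..1} (\<lambda>t. ?v t \<bullet> e) - integral {0..1} (\<lambda>t. ?u t \<bullet> e)"
      by (intro integral_diff integrable_linear[OF ui bounded_linear_inner_left, unfolded o_def]
          integrable_linear[OF vi bounded_linear_inner_left, unfolded o_def])
    also have "\<dots> = integral {0..1} ?v \<bullet> e - integral {0..1} ?u \<bullet> e"
      using ui vi by (simp only: integral_component_eq)
    finally show ?thesis
      by simp
  qed
  then show ?thesis
    by (simp add: euclidean_eq_iff[where 'a = "real^'n"])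
qed

text \<open>
  Square-integrable solutions of the integrated equation $f'' = R f / t^2$, each paired with Cauchy
  data at the regular endpoint 1, namely $f'(1) = b$ and $f(1) = a + b$. Keeping the data as a
  component, rather than as a function of the solution, makes linearity immediate.
\<close>

definition solution_graph :: "(real \<Rightarrow> real^'n^'n) \<Rightarrow> ((real^'n) L2 \<times> (real^'n) \<times> (real^'n)) set"
  where "solution_graph R = {(to_L2 f, a, b) | f a b. square_integrable f \<and>
    (\<forall>t\<in>{0<..1}. f t = a + t *\<^sub>R b + second_primitive (potential_term R f) t)}"

lemma subspace_solution_graph:
  assumes R: "continuous_on {0..1} R"
  shows "subspace (solution_graph R)"
proof (rule subspaceI)
  have "square_integrable (\<lambda>_. 0 :: real^'n)"
    by (rule square_integrable_zero)
  moreover have "second_primitive (potential_term R (\<lambda>_. 0)) t = 0" for t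
    by (simp add: second_primitive_def potential_term_def[abs_def])
  ultimately show "0 \<in> solution_graph R"
    unfolding solution_graph_def zero_prod_def using to_L2_zero
    by (auto intro!: exI[of _ "\<lambda>_. 0"])
next
  fix p q
  assume "p \<in> solution_graph R" "q \<in> solution_graph R"
  then obtain f a b g c d where p: "p = (to_L2 f, a, b)" and q: "q = (to_L2 g, c, d)"
    and f: "square_integrable f" "\<And>t. t \<in> {0<..1} \<Longrightarrow> f t = a + t *\<^sub>R b + second_primitive (potential_term R f) t"
    and g: "square_integrable g" "\<And>t. t \<in> {0<..1} \<Longrightarrow> g t = c + t *\<^sub>R d + second_primitive (potential_term R g) t"
    unfolding solution_graph_def by blast
  let ?h = "\<lambda>t. f t + g t"
  have "second_primitive (potential_term R ?h) t
      = second_primitive (potential_term R f) t + second_primitive (potential_term R g) t" if "0 < t" for t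
    unfolding potential_term_add using that f g
    by (intro second_primitive_add loc_integrable_potential_term R loc_integrable_square_integrable)
  then have "?h t = (a + c) + t *\<^sub>R (b + d) + second_primitive (potential_term R ?h) t" if "t \<in> {0<..1}" for t
    using f(2)[OF that] g(2)[OF that] that by (simp add: scaleR_add_right)
  moreover have "p + q = (to_L2 ?h, a + c, b + d)"
    by (simp add: p q to_L2_add[OF f(1) g(1)])
  moreover have "square_integrable ?h"
    by (rule square_integrable_add[OF f(1) g(1)])
  ultimately show "p + q \<in> solution_graph R"
    unfolding solution_graph_def by blast
next
  fix p k
  assume "p \<in> solution_graph R"
  then obtain f a b where p: "p = (to_L2 f, a, b)"
    and f: "square_integrable f" "\<And>t. t \<in> {0<..1} \<Longrightarrow> f t = a + t *\<^sub>R b + second_primitive (potential_term R f) t"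
    unfolding solution_graph_def by blast
  let ?h = "\<lambda>t. k *\<^sub>R f t"
  have "second_primitive (potential_term R ?h) t = k *\<^sub>R second_primitive (potential_term R f) t" for t
    unfolding potential_term_scaleR by (rule second_primitive_scaleR)
  then have "?h t = (k *\<^sub>R a) + t *\<^sub>R (k *\<^sub>R b) + second_primitive (potential_term R ?h) t" if "t \<in> {0<..1}" for t
    using f(2)[OF that] by (simp add: scaleR_add_right)
  moreover have "k *\<^sub>R p = (to_L2 ?h, k *\<^sub>R a, k *\<^sub>R b)"
    by (simp add: p to_L2_scaleR[OF f(1)])
  moreover have "square_integrable ?h"
    by (rule square_integrable_scaleR[OF f(1)])
  ultimately show "k *\<^sub>R p \<in> solution_graph R"
    unfolding solution_graph_def by blast
qed

text \<open>
  On $[s, 1]$ the coefficient $R(t)/t^2$ is bounded, and Gronwall's argument applies for each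
  $s > 0$.
\<close>

lemma solution_graph_unique:
  fixes R :: "real \<Rightarrow> real^'n^'n"
  assumes R: "continuous_on {0..1} R" and p: "(x, 0) \<in> solution_graph R"
  shows "x = 0"
proof -
  obtain f where x: "x = to_L2 f" and f: "square_integrable f"
    and eq: "\<And>t. t \<in> {0<..1} \<Longrightarrow> f t = second_primitive (potential_term R f) t"
    using p unfolding solution_graph_def zero_prod_def by auto
  note w = loc_integrable_potential_term[OF R loc_integrable_square_integrable[OF f]]
  have "f s = 0" if s: "s \<in> {0<..<1}" for s
  proof -
    have "compact ((\<lambda>t. (1 / t\<^sup>2) *\<^sub>R R t) ` {s..1})"
      using s by (intro compact_continuous_image continuous_intros continuous_on_subset[OF R]) auto
    then obtain C where C: "\<And>t. t \<in> {s..1} \<Longrightarrow> norm ((1 / t\<^sup>2) *\<^sub>R R t) \<le> C"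
      using compact_imp_bounded by (fastforce simp: bounded_iff)
    obtain B where B: "B > 0" "\<And>A v. norm ((A :: real^'n^'n) *v v) \<le> B * norm A * norm v"
      using bilinear_bounded_pos[OF bilinear_matrix_vector_mult] by blast
    have "second_primitive (potential_term R f) s = 0"
    proof (rule second_primitive_gronwall[OF w, of s "B * C"])
      have "0 \<le> C"
        using C[of 1] s norm_ge_zero order_trans by (metis atLeastAtMost_iff greaterThanLessThan_iff less_imp_le order_refl)
      then show "0 \<le> B * C"
        using B(1) by simp
      fix t
      assume t: "t \<in> {s..1}"
      have "norm (potential_term R f t) = norm (((1 / t\<^sup>2) *\<^sub>R R t) *v f t)"
        by (simp add: potential_term_def scaleR_matrix_vector_assoc)
      also have "\<dots> \<le> B * norm ((1 / t\<^sup>2) *\<^sub>R R t) * norm (f t)"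
        by (rule B(2))
      also have "\<dots> \<le> B * C * norm (f t)"
        using C[OF t] B(1) by (intro mult_right_mono mult_left_mono) auto
      also have "f t = second_primitive (potential_term R f) t"
        using eq t s by auto
      finally show "norm (potential_term R f t) \<le> B * C * norm (second_primitive (potential_term R f) t)" .
    qed (use s in auto)
    then show ?thesis
      using eq[of s] s by simp
  qed
  then have "to_L2 f = to_L2 (\<lambda>_. 0)"
    by (intro to_L2_cong f square_integrable_zero AE_I2) simp
  then show ?thesis
    by (simp add: x to_L2_zero)
qed

lemma orthogonal_bessel_range_subset_solutions:
  fixes R :: "real \<Rightarrow> real^'n^'n"
  assumes R: "continuous_on {0..1} R" and sym: "\<And>t. t \<in> {0..1} \<Longrightarrow> transpose (R t) = R t"
    and orth: "\<And>\<Phi>. test_function \<Phi> \<Longrightarrow> x \<bullet> to_L2 (bessel_expr R \<Phi>) = 0"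
  shows "x \<in> fst ` solution_graph R"
proof -
  define g where "g = rep_L2 x"
  have g: "square_integrable g" and x: "x = to_L2 g"
    by (simp_all add: g_def square_integrable_rep_L2 to_L2_rep_L2)
  note gl = loc_integrable_square_integrable[OF g]
  note wl = loc_integrable_potential_term[OF R gl]
  obtain a b where ab: "AE t in I01. g t = a + t *\<^sub>R b + second_primitive (potential_term R g) t"
    using weak_solution_representation[OF gl wl]
      orthogonal_bessel_range_weak_solution[OF R sym g] orth x by blast
  \<comment> \<open>The right-hand side is the continuous representative; it replaces the arbitrary one.\<close>
  define f where "f = (\<lambda>t. a + t *\<^sub>R b + second_primitive (potential_term R g) t)"
  have fg: "AE t in I01. g t = f t"
    using ab by (simp add: f_def)
  have "continuous_on (\<Union>s\<in>{0<..}. {s<..<1}) f"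
    unfolding f_def
    by (intro continuous_on_open_UN continuous_intros continuous_on_subset[OF continuous_second_primitive[OF wl]])
      auto
  moreover have "(\<Union>s\<in>{0<..}. {s<..<1}) = {0<..<1::real}"
    using dense by fastforce
  ultimately have "continuous_on {0<..<1} f"
    by simp
  then have meas: "f \<in> borel_measurable I01"
    by (intro continuous_imp_measurable_on_sets_lebesgue) auto
  have "integrable I01 (\<lambda>t. (norm (g t))\<^sup>2) \<longleftrightarrow> integrable I01 (\<lambda>t. (norm (f t))\<^sup>2)"
    using fg meas g by (intro integrable_cong_AE) (auto simp: square_integrable_def)
  then have f: "square_integrable f"
    using g meas by (simp add: square_integrable_def)
  have "AE t in lebesgue. t \<in> {0<..<1} \<longrightarrow> g t = f t"
    using fg by (simp add: AE_restrict_space_iff)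
  then obtain Z where Z: "negligible Z" "\<And>t. t \<notin> Z \<Longrightarrow> t \<in> {0<..<1} \<Longrightarrow> g t = f t"
    unfolding eventually_ae_filter_negligible by blast
  have "integral {s..1} (potential_term R f) = integral {s..1} (potential_term R g)" if "0 < s" for s
  proof (rule integral_spike[of "insert 1 Z"])
    show "potential_term R g t = potential_term R f t" if "t \<in> {s..1} - insert 1 Z" for t
      using Z(2)[of t] that \<open>0 < s\<close> by (simp add: potential_term_def)
  qed (use Z(1) in simp)
  then have "second_primitive (potential_term R f) t = second_primitive (potential_term R g) t" if "0 < t" for t
    unfolding second_primitive_def using that by (intro integral_cong[of "{t..1}"]) auto
  then have "\<forall>t\<in>{0<..1}. f t = a + t *\<^sub>R b + second_primitive (potential_term R f) t"
    by (simp add: f_def)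
  then have "(to_L2 f, a, b) \<in> solution_graph R"
    using f unfolding solution_graph_def by blast
  moreover have "x = to_L2 f"
    unfolding x by (rule to_L2_cong[OF g f fg])
  ultimately show ?thesis
    by (force simp: image_iff)
qed

lemma finite_dim_orthogonal_bessel_range:
  fixes R :: "real \<Rightarrow> real^'n^'n"
  assumes R: "continuous_on {0..1} R" and sym: "\<And>t. t \<in> {0..1} \<Longrightarrow> transpose (R t) = R t"
  shows "finite_dim {x. \<forall>y\<in>{to_L2 (bessel_expr R \<Phi>) | \<Phi>. test_function \<Phi>}. x \<bullet> y = 0}"
proof (rule finite_dim_of_parametrised[OF subspace_solution_graph[OF R]])
  show "x = 0" if "(x, 0) \<in> solution_graph R" for x
    by (rule solution_graph_unique[OF R that])
  show "{x. \<forall>y\<in>{to_L2 (bessel_expr R \<Phi>) | \<Phi>. test_function \<Phi>}. x \<bullet> y = 0} \<subseteq> fst ` solution_graph R"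
    using orthogonal_bessel_range_subset_solutions[OF R sym] by blast
qed (rule subspace_orthogonal_complement)


section \<open>Coercivity of the Bessel operator on test functions\<close>

text \<open>
  A vector minimising the Rayleigh quotient is an eigenvector: unless the residual
  \<^term>\<open>A *v v - m *\<^sub>R v\<close> vanishes, moving against it decreases the quotient.
\<close>

lemma minimiser_is_eigenvector:
  fixes A :: "real^'n^'n"
  assumes A: "transpose A = A"
    and low: "\<And>w. w \<bullet> (A *v w) \<ge> m * (w \<bullet> w)"
    and v: "v \<bullet> (A *v v) = m * (v \<bullet> v)"
  shows "A *v v = m *\<^sub>R v"
proof -
  define r where "r = A *v v - m *\<^sub>R v"
  define c where "c = r \<bullet> (A *v r) - m * (r \<bullet> r)"
  have c: "0 \<le> c"
    using low[of r] by (simp add: c_def)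
  have ineq: "2 * \<delta> * (r \<bullet> r) \<le> \<delta>\<^sup>2 * c" for \<delta>
  proof -
    let ?w = "v - \<delta> *\<^sub>R r"
    have "v \<bullet> (A *v r) = (A *v v) \<bullet> r"
      by (rule symmetric_matrix_inner[OF A])
    then have "?w \<bullet> (A *v ?w) - m * (?w \<bullet> ?w)
        = (v \<bullet> (A *v v) - m * (v \<bullet> v)) - 2 * \<delta> * (r \<bullet> (A *v v - m *\<^sub>R v)) + \<delta>\<^sup>2 * c"
      by (simp add: c_def matrix_vector_mult_diff_distrib matrix_vector_mult_scaleR inner_diff_left
          inner_diff_right inner_commute algebra_simps power2_eq_square)
    then show ?thesis
      using low[of ?w] v by (simp add: r_def[symmetric])
  qed
  \<comment> \<open>Essentially the optimal step length; adding 1 avoids a division by zero.\<close>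
  have "2 * (r \<bullet> r) * (r \<bullet> r) / (c + 1) \<le> (r \<bullet> r)\<^sup>2 * c / (c + 1)\<^sup>2"
    using ineq[of "(r \<bullet> r) / (c + 1)"] by (simp add: power_divide algebra_simps)
  also have "\<dots> \<le> (r \<bullet> r)\<^sup>2 * (c + 1) / (c + 1)\<^sup>2"
    using c by (intro divide_right_mono mult_left_mono) auto
  also have "\<dots> = (r \<bullet> r)\<^sup>2 / (c + 1)"
    using c by (simp add: power2_eq_square)
  finally have "(r \<bullet> r)\<^sup>2 / (c + 1) \<le> 0"
    by (simp add: power2_eq_square)
  then have "(r \<bullet> r)\<^sup>2 \<le> 0"
    using c by (simp add: divide_le_0_iff)
  then have "r = 0"
    by simp
  then show ?thesis
    by (simp add: r_def)
qed

text \<open>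
  The form attains its minimum over the compact set of pairs of a time and a unit vector. The minimum
  is an eigenvalue, so the strict bound on the eigenvalues is uniform.
\<close>

lemma uniform_lower_bound:
  fixes R :: "real \<Rightarrow> real^'n^'n"
  assumes R: "continuous_on {0..1} R"
    and sym: "\<And>t. t \<in> {0..1} \<Longrightarrow> transpose (R t) = R t"
    and eig: "\<And>t c v. t \<in> {0..1} \<Longrightarrow> v \<noteq> 0 \<Longrightarrow> R t *v v = c *\<^sub>R v \<Longrightarrow> c > \<mu>"
  shows "\<exists>m>\<mu>. \<forall>t\<in>{0..1}. \<forall>v. v \<bullet> (R t *v v) \<ge> m * (v \<bullet> v)"
proof -
  define K where "K = {0..1::real} \<times> sphere (0 :: real^'n) 1"
  define q where "q = (\<lambda>(t, v). v \<bullet> (R t *v v))"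
  obtain e :: "real^'n" where "norm e = 1"
    using vector_choose_size[of 1] by auto
  then have "(0, e) \<in> K"
    by (simp add: K_def)
  moreover have "compact K"
    unfolding K_def by (intro compact_Times) auto
  moreover have "continuous_on K q"
    unfolding q_def case_prod_beta matrix_vector_mult_def K_def
    by (intro continuous_intros continuous_on_vec_lambda continuous_on_compose2[OF R]) auto
  ultimately obtain p where p: "p \<in> K" "\<And>p'. p' \<in> K \<Longrightarrow> q p \<le> q p'"
    using continuous_attains_inf[of K q] by blast
  obtain t0 v0 where p0: "p = (t0, v0)" "t0 \<in> {0..1}" "norm v0 = 1"
    using p(1) by (auto simp: K_def)
  define m where "m = q p"
  have low: "m * (v \<bullet> v) \<le> v \<bullet> (R t *v v)" if t: "t \<in> {0..1}" for t v
  proof (cases "v = 0")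
    case False
    define w where "w = (1 / norm v) *\<^sub>R v"
    have "(t, w) \<in> K"
      using t False by (simp add: K_def w_def)
    then have "m \<le> w \<bullet> (R t *v w)"
      using p(2) by (force simp: m_def q_def)
    also have "\<dots> = (v \<bullet> (R t *v v)) / (v \<bullet> v)"
      by (simp add: w_def matrix_vector_mult_scaleR dot_square_norm power2_eq_square)
    finally show ?thesis
      using False by (simp add: field_simps)
  qed simp
  have "R t0 *v v0 = m *\<^sub>R v0"
  proof (rule minimiser_is_eigenvector[OF sym[OF p0(2)] low[OF p0(2)]])
    show "v0 \<bullet> (R t0 *v v0) = m * (v0 \<bullet> v0)"
      using p0 by (simp add: m_def q_def dot_square_norm)
  qed
  then have "m > \<mu>"
    using eig[OF p0(2), of v0 m] p0(3) by fastforce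
  then show ?thesis
    using low by blast
qed

text \<open>
  Hardy's inequality in differential form. Completing the square gives
  \[ -\varphi''\cdot\varphi - \tfrac{|\varphi|^2}{4t^2}
     = \Bigl|\varphi' - \tfrac{\varphi}{2t}\Bigr|^2 + G', \qquad
     G = \tfrac{|\varphi|^2}{2t} - \varphi'\cdot\varphi, \]
  and the total derivative integrates to zero. The excess of the potential over $-1/(4t^2)$ remains.
\<close>

lemma bessel_coercive_inner:
  fixes R :: "real \<Rightarrow> real^'n^'n"
  assumes R: "continuous_on {0..1} R" and \<phi>: "test_function \<phi>" and \<epsilon>: "0 \<le> \<epsilon>"
    and low: "\<And>t v. t \<in> {0..1} \<Longrightarrow> (\<epsilon> - 1/4) * (v \<bullet> v) \<le> v \<bullet> (R t *v v)"
  shows "\<epsilon> * (norm (to_L2 \<phi>))\<^sup>2 \<le> to_L2 (bessel_expr R \<phi>) \<bullet> to_L2 \<phi>"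
proof -
  obtain \<alpha> \<beta> where ab: "0 < \<alpha>" "\<alpha> < \<beta>" "\<beta> < 1" "\<And>k t. t \<notin> {\<alpha>..\<beta>} \<Longrightarrow> iter_deriv k \<phi> t = 0"
    by (rule test_functionE[OF \<phi>]) blast
  \<comment> \<open>Enlarging the support makes \<open>G\<close> vanish at both ends.\<close>
  define p where "p = \<alpha> / 2"
  define q where "q = (\<beta> + 1) / 2"
  have pq: "0 < p" "p \<le> q" "q < 1" "p < \<alpha>" "\<beta> < q"
    using ab by (auto simp: p_def q_def)
  define \<phi>1 where "\<phi>1 = iter_deriv 1 \<phi>"
  define \<phi>2 where "\<phi>2 = iter_deriv 2 \<phi>"
  have out: "\<phi> t = 0" "\<phi>1 t = 0" if "t \<notin> {p<..<q}" for t
  proof -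
    have "t \<notin> {\<alpha>..\<beta>}"
      using that pq by auto
    from ab(4)[OF this, of 0] ab(4)[OF this, of 1] show "\<phi> t = 0" "\<phi>1 t = 0"
      by (simp_all add: \<phi>1_def)
  qed
  have d: "(\<phi> has_vector_derivative \<phi>1 t) (at t)" "(\<phi>1 has_vector_derivative \<phi>2 t) (at t)" for t
    using test_function_deriv[OF \<phi>, of 0 t] test_function_deriv[OF \<phi>, of 1 t]
    by (simp_all add: \<phi>1_def \<phi>2_def numeral_2_eq_2)
  have cont: "continuous_on S \<phi>" "continuous_on S \<phi>1" "continuous_on S \<phi>2" for S
    using iter_deriv_continuous[OF \<phi>, of S] iter_deriv_0[of \<phi>] unfolding \<phi>1_def \<phi>2_def by metis+
  define G where "G = (\<lambda>t. (\<phi> t \<bullet> \<phi> t) * (1 / (2 * t)) - \<phi>1 t \<bullet> \<phi> t)"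
  define G' where "G' = (\<lambda>t. 2 * (\<phi> t \<bullet> \<phi>1 t) * (1 / (2 * t)) - (\<phi> t \<bullet> \<phi> t) * (1 / (2 * t\<^sup>2))
    - (\<phi>1 t \<bullet> \<phi>1 t + \<phi>2 t \<bullet> \<phi> t))"
  have "(G' has_integral G q - G p) {p..q}"
  proof (rule fundamental_theorem_of_calculus[OF pq(2)])
    fix t
    assume "t \<in> {p..q}"
    then have t: "t > 0"
      using pq by auto
    have 1: "((\<lambda>t. \<phi> t \<bullet> \<phi> t) has_real_derivative 2 * (\<phi> t \<bullet> \<phi>1 t)) (at t)"
      using bounded_bilinear.has_vector_derivative[OF bounded_bilinear_inner d(1)[of t] d(1)[of t]]
      by (simp add: has_real_derivative_iff_has_vector_derivative inner_commute)
    have 2: "((\<lambda>t. \<phi>1 t \<bullet> \<phi> t) has_real_derivative \<phi>1 t \<bullet> \<phi>1 t + \<phi>2 t \<bullet> \<phi> t) (at t)"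
      using bounded_bilinear.has_vector_derivative[OF bounded_bilinear_inner d(2)[of t] d(1)[of t]]
      by (simp add: has_real_derivative_iff_has_vector_derivative)
    have 3: "((\<lambda>t. 1 / (2 * t)) has_real_derivative - (1 / (2 * t\<^sup>2))) (at t)"
      using t by (auto intro!: derivative_eq_intros simp: power2_eq_square field_simps)
    have "(G has_real_derivative G' t) (at t)"
      unfolding G_def by (rule DERIV_cong[OF DERIV_diff[OF DERIV_mult[OF 1 3] 2]]) (simp add: G'_def)
    then show "(G has_vector_derivative G' t) (at t within {p..q})"
      by (simp add: has_real_derivative_iff_has_vector_derivative has_vector_derivative_at_within)
  qed
  then have "(G' has_integral 0) {p..q}"
    using out[of p] out[of q] by (simp add: G_def)
  moreover have G'_out: "G' t = 0" if "t \<notin> {p..q}" for t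
    using out[of t] that by (auto simp: G'_def)
  ultimately have "(G' has_integral 0) {0<..<1}"
    by (rule has_integral_on_superset) (use pq in auto)
  moreover have G'_int: "integrable I01 G'"
  proof (rule square_integrable_integrable, rule square_integrable_continuous_supp[of _ "{p..q}"])
    show "continuous_on {0<..<1} G'"
      unfolding G'_def by (intro continuous_intros cont) auto
  qed (use pq G'_out in auto)
  ultimately have G'_0: "(LINT t|I01. G' t) = 0"
    using lebesgue_integral_eq_integral[OF G'_int] by (simp add: integral_unique)
  note f = square_integrable_test_function[OF \<phi>] and b = square_integrable_bessel_expr[OF \<phi> R]
  have pt: "G' t + \<epsilon> * (norm (\<phi> t))\<^sup>2 \<le> bessel_expr R \<phi> t \<bullet> \<phi> t" if t: "t \<in> {0<..<1}" for t
  proof -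
    have "0 \<le> (\<phi>1 t - (1 / (2 * t)) *\<^sub>R \<phi> t) \<bullet> (\<phi>1 t - (1 / (2 * t)) *\<^sub>R \<phi> t)"
      by simp
    also have "\<dots> = \<phi>1 t \<bullet> \<phi>1 t - (\<phi> t \<bullet> \<phi>1 t) / t + (\<phi> t \<bullet> \<phi> t) / (4 * t\<^sup>2)"
      using t by (simp add: inner_diff_left inner_diff_right inner_commute field_simps power2_eq_square)
    finally have sq: "0 \<le> \<phi>1 t \<bullet> \<phi>1 t - (\<phi> t \<bullet> \<phi>1 t) / t + (\<phi> t \<bullet> \<phi> t) / (4 * t\<^sup>2)" .
    have "(\<epsilon> - 1/4) * (\<phi> t \<bullet> \<phi> t) / t\<^sup>2 \<le> (\<phi> t \<bullet> (R t *v \<phi> t)) / t\<^sup>2"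
      using low[of t "\<phi> t"] t by (intro divide_right_mono) auto
    moreover have "\<epsilon> * (\<phi> t \<bullet> \<phi> t) * 1 \<le> \<epsilon> * (\<phi> t \<bullet> \<phi> t) * (1 / t\<^sup>2)"
    proof (intro mult_left_mono)
      show "1 \<le> 1 / t\<^sup>2"
        using t by (simp add: power_le_one)
    qed (use \<epsilon> in simp)
    moreover have "bessel_expr R \<phi> t \<bullet> \<phi> t = - (\<phi>2 t \<bullet> \<phi> t) + (\<phi> t \<bullet> (R t *v \<phi> t)) / t\<^sup>2"
      by (simp add: bessel_expr_def \<phi>2_def inner_diff_right inner_commute)
    moreover define x where "x = (\<phi> t \<bullet> \<phi> t) / t\<^sup>2"
    moreover have "(\<epsilon> - 1/4) * (\<phi> t \<bullet> \<phi> t) / t\<^sup>2 = \<epsilon> * x - x / 4"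
      by (simp add: x_def left_diff_distrib diff_divide_distrib)
    moreover have "(\<phi> t \<bullet> \<phi> t) / (4 * t\<^sup>2) = x / 4" "\<epsilon> * (\<phi> t \<bullet> \<phi> t) * (1 / t\<^sup>2) = \<epsilon> * x"
      by (simp_all add: x_def)
    moreover have "G' t = (\<phi> t \<bullet> \<phi>1 t) / t - x / 2 - (\<phi>1 t \<bullet> \<phi>1 t + \<phi>2 t \<bullet> \<phi> t)"
      by (simp add: G'_def x_def)
    ultimately show ?thesis
      using sq unfolding power2_norm_eq_inner by argo
  qed
  have norm_int: "integrable I01 (\<lambda>t. (norm (\<phi> t))\<^sup>2)"
    using f by (simp add: square_integrable_def)
  have "\<epsilon> * (norm (to_L2 \<phi>))\<^sup>2 = (LINT t|I01. G' t + \<epsilon> * (norm (\<phi> t))\<^sup>2)"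
    using G'_0 G'_int norm_int by (simp add: norm_to_L2[OF f])
  also have "\<dots> \<le> (LINT t|I01. bessel_expr R \<phi> t \<bullet> \<phi> t)"
    using pt by (intro integral_mono square_integrable_inner b f
        Bochner_Integration.integrable_add G'_int integrable_mult_right norm_int) auto
  also have "\<dots> = to_L2 (bessel_expr R \<phi>) \<bullet> to_L2 \<phi>"
    by (rule inner_to_L2[OF b f, symmetric])
  finally show ?thesis .
qed

lemma bessel_coercive_norm:
  fixes R :: "real \<Rightarrow> real^'n^'n"
  assumes R: "continuous_on {0..1} R" and \<phi>: "test_function \<phi>" and \<epsilon>: "0 \<le> \<epsilon>"
    and low: "\<And>t v. t \<in> {0..1} \<Longrightarrow> (\<epsilon> - 1/4) * (v \<bullet> v) \<le> v \<bullet> (R t *v v)"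
  shows "\<epsilon> * norm (to_L2 \<phi>) \<le> norm (to_L2 (bessel_expr R \<phi>))"
proof -
  have "(\<epsilon> * norm (to_L2 \<phi>)) * norm (to_L2 \<phi>) \<le> norm (to_L2 (bessel_expr R \<phi>)) * norm (to_L2 \<phi>)"
    using order_trans[OF bessel_coercive_inner[OF R \<phi> \<epsilon> low] norm_cauchy_schwarz]
    by (simp add: power2_eq_square mult.assoc)
  then show ?thesis
    by (cases "norm (to_L2 \<phi>) = 0") (auto simp: mult_le_cancel_right)
qed


section \<open>Self-adjoint extensions\<close>

lemma closed_op_adjoint: "closed (op_adjoint A)"
proof -
  have "op_adjoint A = (\<Inter>p\<in>A. {q. snd p \<bullet> fst q = fst p \<bullet> snd q})"
    by (fastforce simp: op_adjoint_def)
  then show ?thesis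
    by (auto intro!: closed_INT closed_Collect_eq continuous_intros)
qed

lemma subspace_op_range:
  assumes "operator A"
  shows "subspace (Range A)"
proof -
  have "Range A = snd ` A"
    by force
  then show ?thesis
    using assms by (simp add: operator_def linear_subspace_image linear_snd)
qed

lemma subspace_op_kernel:
  assumes "operator A"
  shows "subspace (op_kernel A)"
proof (rule subspaceI)
  have A: "subspace A"
    using assms by (simp add: operator_def)
  show "0 \<in> op_kernel A"
    using subspace_0[OF A] by (simp add: op_kernel_def zero_prod_def)
  show "x + y \<in> op_kernel A" if "x \<in> op_kernel A" "y \<in> op_kernel A" for x y
    using subspace_add[OF A, of "(x, 0)" "(y, 0)"] that by (simp add: op_kernel_def)
  show "c *\<^sub>R x \<in> op_kernel A" if "x \<in> op_kernel A" for c x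
    using subspace_scale[OF A, of "(x, 0)" c] that by (simp add: op_kernel_def)
qed

lemma op_kernel_orthogonal_Range:
  assumes "A \<subseteq> op_adjoint A" "x \<in> op_kernel A" "y \<in> Range A"
  shows "x \<bullet> y = 0"
proof -
  obtain z where z: "(z, y) \<in> A"
    using assms(3) by blast
  have "(x, 0) \<in> op_adjoint A"
    using assms(1,2) by (auto simp: op_kernel_def)
  then have "y \<bullet> x = z \<bullet> 0"
    using z unfolding op_adjoint_def by blast
  then show ?thesis
    by (simp add: inner_commute)
qed

text \<open>
  The inverse of an operator that is bounded below is continuous, so preimages of a convergent
  sequence of values form a Cauchy sequence.
\<close>

lemma closure_range_subset_range_closure:
  fixes G :: "('a::{real_inner,complete_space} \<times> 'a) set"
  assumes G: "subspace G" and \<epsilon>: "\<epsilon> > 0"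
    and low: "\<And>x y. (x, y) \<in> G \<Longrightarrow> \<epsilon> * norm x \<le> norm y"
  shows "closure (snd ` G) \<subseteq> snd ` closure G"
proof
  fix y
  assume "y \<in> closure (snd ` G)"
  then obtain Y where Y: "\<And>k. Y k \<in> snd ` G" "Y \<longlonglongrightarrow> y"
    unfolding closure_sequential by blast
  have "\<exists>x. (x, Y k) \<in> G" for k
    using Y(1)[of k] by force
  then obtain X where X: "\<And>k. (X k, Y k) \<in> G"
    by metis
  have "Cauchy X"
  proof (rule metric_CauchyI)
    fix e :: real
    assume "0 < e"
    then have "0 < \<epsilon> * e"
      using \<epsilon> by simp
    then obtain K where K: "\<And>j k. j \<ge> K \<Longrightarrow> k \<ge> K \<Longrightarrow> dist (Y j) (Y k) < \<epsilon> * e"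
      using metric_CauchyD[OF LIMSEQ_imp_Cauchy[OF Y(2)]] by blast
    have "dist (X j) (X k) < e" if "j \<ge> K" "k \<ge> K" for j k
    proof -
      have "(X j - X k, Y j - Y k) \<in> G"
        using subspace_diff[OF G X[of j] X[of k]] by simp
      then have "\<epsilon> * dist (X j) (X k) \<le> dist (Y j) (Y k)"
        using low by (simp add: dist_norm)
      also have "\<dots> < \<epsilon> * e"
        by (rule K[OF that])
      finally show ?thesis
        using \<epsilon> by simp
    qed
    then show "\<exists>K. \<forall>j\<ge>K. \<forall>k\<ge>K. dist (X j) (X k) < e"
      by blast
  qed
  then obtain x where "X \<longlonglongrightarrow> x"
    using Cauchy_convergent_iff convergent_def by blast
  then have "(\<lambda>k. (X k, Y k)) \<longlonglongrightarrow> (x, y)"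
    using Y(2) by (rule tendsto_Pair)
  then have "(x, y) \<in> closure G"
    using X unfolding closure_sequential by (intro exI[of _ "\<lambda>k. (X k, Y k)"]) simp
  then show "y \<in> snd ` closure G"
    by force
qed

text \<open>
  The range contains the closure of the range of \<^term>\<open>G\<close> because \<^term>\<open>G\<close> is bounded below, and the
  orthogonal complement of the latter bounds both the cokernel and, by symmetry, the kernel.
\<close>

lemma fredholm_self_adjoint_extension:
  fixes A G :: "('a::{real_inner,complete_space}) opgraph"
  assumes A: "self_adjoint A" and G: "subspace G" "closure G \<subseteq> A"
    and \<epsilon>: "\<epsilon> > 0" and low: "\<And>x y. (x, y) \<in> G \<Longrightarrow> \<epsilon> * norm x \<le> norm y"
    and fin: "finite_dim {x. \<forall>y\<in>snd ` G. x \<bullet> y = 0}"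
  shows "fredholm A"
proof -
  define M where "M = closure (snd ` G)"
  have A': "operator A" "op_adjoint A = A"
    using A by (auto simp: self_adjoint_def)
  have M: "subspace M"
    unfolding M_def using G(1) by (intro closure_subspace linear_subspace_image linear_snd)
  have "complete M"
    unfolding M_def by (simp add: complete_eq_closed)
  moreover have MR: "M \<subseteq> Range A"
    using closure_range_subset_range_closure[OF G(1) \<epsilon> low] G(2) unfolding M_def by force
  moreover have sub: "snd ` G \<subseteq> M"
    unfolding M_def by (rule closure_subset)
  moreover have perp: "{x. \<forall>y\<in>M. x \<bullet> y = 0} = {x. \<forall>y\<in>snd ` G. x \<bullet> y = 0}"
  proof (intro equalityI subsetI CollectI ballI)
    fix x y
    assume "x \<in> {x. \<forall>y\<in>snd ` G. x \<bullet> y = 0}" "y \<in> M"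
    moreover have "closed {y. x \<bullet> y = 0}"
      by (intro closed_Collect_eq continuous_intros)
    ultimately show "x \<bullet> y = 0"
      using closure_minimal[of "snd ` G" "{y. x \<bullet> y = 0}"] by (auto simp: M_def)
  qed (use sub in blast)
  ultimately have "closed (Range A)" "finite_codim (Range A)"
    using closed_of_finite_codim[OF subspace_op_range[OF A'(1)] M] fin by auto
  moreover have "finite_dim (op_kernel A)"
  proof -
    obtain B where B: "finite B" "span B = {x. \<forall>y\<in>M. x \<bullet> y = 0}"
      using fin perp by (auto simp: finite_dim_def)
    have "op_kernel A \<subseteq> span B"
      unfolding B(2) using op_kernel_orthogonal_Range[of A] A'(2) subsetD[OF MR] by simp blast
    then show ?thesis
      by (rule finite_dim_subspace[OF subspace_op_kernel[OF A'(1)] _ B(1)])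
  qed
  moreover have "closed A"
    using closed_op_adjoint[of A] A'(2) by simp
  ultimately show ?thesis
    using A'(1) by (simp add: fredholm_def closed_operator_def)
qed

lemma subspace_bessel_graph:
  fixes R :: "real \<Rightarrow> real^'n^'n"
  assumes R: "continuous_on {0..1} R"
  shows "subspace {(to_L2 \<phi>, to_L2 (bessel_expr R \<phi>)) | \<phi>. test_function \<phi>}"
proof -
  let ?f = "\<lambda>\<phi>. (to_L2 \<phi>, to_L2 (bessel_expr R \<phi>))"
  have comb: "a *\<^sub>R ?f \<phi> + b *\<^sub>R ?f \<psi> = ?f (\<lambda>t. a *\<^sub>R \<phi> t + b *\<^sub>R \<psi> t)"
    if \<phi>: "test_function \<phi>" and \<psi>: "test_function \<psi>" for a b and \<phi> \<psi> :: "real \<Rightarrow> real^'n"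
  proof -
    have "bessel_expr R (\<lambda>t. a *\<^sub>R \<phi> t + b *\<^sub>R \<psi> t)
        = (\<lambda>t. a *\<^sub>R bessel_expr R \<phi> t + b *\<^sub>R bessel_expr R \<psi> t)"
      using smooth_linear_combination(2)[OF test_function_smooth[OF \<phi>] test_function_smooth[OF \<psi>], of 2 a b]
      by (simp add: fun_eq_iff bessel_expr_def matrix_vector_right_distrib matrix_vector_mult_scaleR
          algebra_simps)
    then show ?thesis
      using square_integrable_test_function[OF \<phi>] square_integrable_test_function[OF \<psi>]
        square_integrable_bessel_expr[OF \<phi> R] square_integrable_bessel_expr[OF \<psi> R]
      by (simp add: to_L2_scaleR to_L2_add square_integrable_scaleR)
  qed
  have closed: "a *\<^sub>R p + b *\<^sub>R q \<in> {?f \<phi> | \<phi>. test_function \<phi>}"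
    if pq: "p \<in> {?f \<phi> | \<phi>. test_function \<phi>}" "q \<in> {?f \<phi> | \<phi>. test_function \<phi>}" for a b p q
  proof -
    obtain \<phi> \<psi> where "test_function \<phi>" "test_function \<psi>" "p = ?f \<phi>" "q = ?f \<psi>"
      using pq by blast
    then show ?thesis
      using comb[of \<phi> \<psi> a b] test_function_linear_combination[of \<phi> \<psi> a b]
      by (intro CollectI exI[of _ "\<lambda>t. a *\<^sub>R \<phi> t + b *\<^sub>R \<psi> t"]) simp
  qed
  have "test_function (\<lambda>t. bump 1 (1/3) (2/3) t *\<^sub>R (0 :: real^'n))"
    by (intro test_function_scaleR test_function_bump) auto
  then have ne: "?f (\<lambda>t. bump 1 (1/3) (2/3) t *\<^sub>R 0) \<in> {?f \<phi> | \<phi>. test_function \<phi>}"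
    by blast
  show ?thesis
  proof (rule subspaceI)
    show "0 \<in> {?f \<phi> | \<phi>. test_function \<phi>}"
      using closed[OF ne ne, of 0 0] by (simp only: scaleR_zero_left add_0)
    show "p + q \<in> {?f \<phi> | \<phi>. test_function \<phi>}"
      if "p \<in> {?f \<phi> | \<phi>. test_function \<phi>}" "q \<in> {?f \<phi> | \<phi>. test_function \<phi>}" for p q
      using closed[OF that, of 1 1] by (simp only: scaleR_one)
    show "c *\<^sub>R p \<in> {?f \<phi> | \<phi>. test_function \<phi>}" if "p \<in> {?f \<phi> | \<phi>. test_function \<phi>}" for c p
      using closed[OF that that, of c 0] by (simp only: scaleR_zero_left add_0_right)
  qed
qed

theorem theorem4:
  fixes R :: "real \<Rightarrow> real^'n^'n" and A :: "(real^'n) L2 opgraph"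
  assumes "continuous_on {0..1} R"
    and "\<And>t. t \<in> {0..1} \<Longrightarrow> transpose (R t) = R t"
    and "\<And>t c v. t \<in> {0..1} \<Longrightarrow> v \<noteq> 0 \<Longrightarrow> R t *v v = c *\<^sub>R v \<Longrightarrow> c > -1/4"
    and "self_adjoint A"
    and "minimal_operator R \<subseteq> A"
  shows "fredholm A"
proof -
  let ?G = "{(to_L2 \<phi>, to_L2 (bessel_expr R \<phi>)) | \<phi>. test_function \<phi>}"
  have "\<exists>m>- 1/4. \<forall>t\<in>{0..1}. \<forall>v. v \<bullet> (R t *v v) \<ge> m * (v \<bullet> v)"
    by (rule uniform_lower_bound[OF assms(1,2)]) (use assms(3) in auto)
  then obtain m where m: "m > - 1/4" "\<And>t v. t \<in> {0..1} \<Longrightarrow> m * (v \<bullet> v) \<le> v \<bullet> (R t *v v)"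
    by blast
  define \<epsilon> where "\<epsilon> = m + 1/4"
  have \<epsilon>: "\<epsilon> > 0" "m = \<epsilon> - 1/4"
    using m(1) by (simp_all add: \<epsilon>_def)
  show ?thesis
  proof (rule fredholm_self_adjoint_extension[OF assms(4) subspace_bessel_graph[OF assms(1)] _ \<epsilon>(1)])
    show "closure ?G \<subseteq> A"
      using assms(5) by (simp add: minimal_operator_def)
    show "\<epsilon> * norm x \<le> norm y" if "(x, y) \<in> ?G" for x y
      using that bessel_coercive_norm[OF assms(1) _ less_imp_le[OF \<epsilon>(1)] m(2)[unfolded \<epsilon>(2)]] by auto
    have "snd ` ?G = {to_L2 (bessel_expr R \<phi>) | \<phi>. test_function \<phi>}"
      by force
    then show "finite_dim {x. \<forall>y\<in>snd ` ?G. x \<bullet> y = 0}"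
      using finite_dim_orthogonal_bessel_range[OF assms(1,2)] by simp
  qed
qed


end
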